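(* Let $M^n$ be a closed, oriented minimal hypersurface of $\mathbb S^{n+1}$. If $2\leq n\leq 14$ and $M^n$ is not totally geodesic, then $CM$ is a minimal unstable hypersurface of $\mathbb S^{n+2}$.
   Context: "Closed" means compact without boundary; a hypersurface is a codimension-one isometric immersion. $\mathbb S^{n+1}$ is regarded as the equator of the unit sphere $\mathbb S^{n+2}\subset\mathbb R^{n+3}$ with respect to the North pole $P=(0,\ldots,0,1)$, identifying $x\in\mathbb S^{n+1}$ with $(x,0)\in\mathbb S^{n+2}$. The map $(t,x)\mapsto(\cos t)x+(\sin t)P$ is an isometry from the warped product $(-\frac\pi2,\frac\pi2)\times_{\cos t}\mathbb S^{n+1}$ (metric $dt^2+\cos^2t\,g_{\mathbb S^{n+1}}$) onto $\mathbb S^{n+2}\setminus\{\pm P\}$. Let $\varphi:M^n\to\mathbb S^{n+1}$ be the immersion. For $0<\epsilon<\frac\pi2$, the $\epsilon$-truncated (spherical) cone $C_\epsilon M$ is $M\times[-\epsilon,0]$ with the metric induced by the immersion $\Phi(p,t)=(\cos t)\varphi(p)+(\sin t)P$ into $\mathbb S^{n+2}$. The cone $CM$ is given by the same formula with $t\in(-\frac\pi2,0]$ (its vertex being the limit point $-P$); it is minimal if this immersion, away from the vertex, has zero mean curvature. Let $N$ be the unit normal field of $C_\epsilon M$ in $\mathbb S^{n+2}$ obtained from the unit normal field orienting $M$ in $\mathbb S^{n+1}$ by parallel transport along the curves $t\mapsto\Phi(p,t)$. For $G\in C^\infty(C_\epsilon M)$ vanishing on $\partial(C_\epsilon M)$,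 let $I(G)$ be the index form of $C_\epsilon M$ in the direction $GN$ (second variation of area for variations fixing the boundary), classically given by $$I(G)=\int_{C_\epsilon M}\left(-G\,\Delta_{C_\epsilon M}G-(\overline{\mathrm{Ric}}(N,N)+\|A^N\|^2)G^2\right)d(C_\epsilon M),$$ where $\overline{\mathrm{Ric}}$ is the Ricci tensor of $\mathbb S^{n+2}$ and $A^N$ is the shape operator of $C_\epsilon M$. $C_\epsilon M$ is unstable if $I(G)<0$ for some such $G$, and $CM$ is unstable if $C_\epsilon M$ is unstable for some $\epsilon\in(0,\frac\pi2)$. *)

theory Defs
  imports "HOL-Analysis.Analysis"
begin

section \<open>Smooth manifolds given by charts\<close>

text \<open>The set \<open>S\<close> is meant to be open.\<close>

primrec Ck_on :: "nat \<Rightarrow> 'a::euclidean_space set \<Rightarrow> ('a \<Rightarrow> 'b::euclidean_space) \<Rightarrow> bool" where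
  "Ck_on 0 S f \<longleftrightarrow> continuous_on S f"
| "Ck_on (Suc k) S f \<longleftrightarrow> f differentiable_on S \<and>
     (\<forall>v. Ck_on k S (\<lambda>x. frechet_derivative f (at x) v))"

definition smooth_on :: "'a::euclidean_space set \<Rightarrow> ('a \<Rightarrow> 'b::euclidean_space) \<Rightarrow> bool" where
  "smooth_on S f \<longleftrightarrow> (\<forall>k. Ck_on k S f)"

text \<open>A chart is a pair \<open>(U, x)\<close> of an open set \<open>U\<close> and a coordinate map \<open>x\<close>, of which only the
  values on \<open>U\<close> matter.  The underlying space of an atlas is the union of the chart domains, an
  open subset of an ambient Hausdorff type; its dimension \<open>n\<close> is \<open>DIM('e)\<close>.\<close>

type_synonym ('m, 'e) chart = "'m set \<times> ('m \<Rightarrow> 'e)"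

abbreviation chart_dom :: "('m, 'e) chart \<Rightarrow> 'm set" where
  "chart_dom c \<equiv> fst c"

abbreviation chart_cod :: "('m, 'e) chart \<Rightarrow> 'e set" where
  "chart_cod c \<equiv> snd c ` fst c"

abbreviation param :: "('m, 'e) chart \<Rightarrow> 'e \<Rightarrow> 'm" where
  "param c \<equiv> inv_into (fst c) (snd c)"

definition smooth_atlas :: "('m::t2_space, 'e::euclidean_space) chart set \<Rightarrow> bool" where
  "smooth_atlas A \<longleftrightarrow>
     (\<forall>c\<in>A. open (chart_dom c) \<and> open (chart_cod c) \<and>
        homeomorphism (chart_dom c) (chart_cod c) (snd c) (param c)) \<and>
     (\<forall>c\<in>A. \<forall>d\<in>A. smooth_on (snd c ` (chart_dom c \<inter> chart_dom d)) (snd d \<circ> param c))"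

definition manifold :: "('m, 'e) chart set \<Rightarrow> 'm set" where
  "manifold A = (\<Union>c\<in>A. chart_dom c)"

text \<open>Compact without boundary.  Second countability is automatic for a compact manifold.\<close>

definition closed_manifold :: "('m::t2_space, 'e::euclidean_space) chart set \<Rightarrow> bool" where
  "closed_manifold A \<longleftrightarrow> smooth_atlas A \<and> compact (manifold A)"

definition smooth_map ::
  "('m::t2_space, 'e::euclidean_space) chart set \<Rightarrow> 'm set \<Rightarrow> ('m \<Rightarrow> 'w::euclidean_space) \<Rightarrow> bool" where
  "smooth_map A W f \<longleftrightarrow> (\<forall>c\<in>A. smooth_on (snd c ` (chart_dom c \<inter> W)) (f \<circ> param c))"

text \<open>Smoothness on a subset \<open>K\<close> that need not be open (such as a domain with boundary): local
  extendability to smooth functions.\<close>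

definition smooth_map_on ::
  "('m::t2_space, 'e::euclidean_space) chart set \<Rightarrow> 'm set \<Rightarrow> ('m \<Rightarrow> 'w::euclidean_space) \<Rightarrow> bool" where
  "smooth_map_on A K f \<longleftrightarrow>
     (\<forall>p\<in>K. \<exists>W h. open W \<and> p \<in> W \<and> smooth_map A W h \<and> (\<forall>q\<in>W \<inter> K. h q = f q))"


section \<open>Riemannian geometry of a metric in local coordinates\<close>

text \<open>A metric \<open>g\<close> on an open subset of \<open>'e\<close> sends a point \<open>y\<close> to the bilinear form
  \<open>g y\<close>.  Vectors of \<open>'e\<close> double as coordinate vector fields with constant coefficients.\<close>

type_synonym 'e metric = "'e \<Rightarrow> 'e \<Rightarrow> 'e \<Rightarrow> real"

definition trace_op :: "('e::euclidean_space \<Rightarrow> 'e) \<Rightarrow> real" where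
  "trace_op L = (\<Sum>b\<in>Basis. L b \<bullet> b)"

definition sharp :: "'e::euclidean_space metric \<Rightarrow> 'e \<Rightarrow> ('e \<Rightarrow> real) \<Rightarrow> 'e" where
  "sharp g y l = (THE u. \<forall>w. g y u w = l w)"

text \<open>Levi-Civita derivative of constant fields, by the Koszul formula.\<close>

definition christoffel :: "'e::euclidean_space metric \<Rightarrow> 'e \<Rightarrow> 'e \<Rightarrow> 'e \<Rightarrow> 'e" where
  "christoffel g y v w = sharp g y (\<lambda>z.
     (frechet_derivative (\<lambda>x. g x w z) (at y) v
    + frechet_derivative (\<lambda>x. g x v z) (at y) w
    - frechet_derivative (\<lambda>x. g x v w) (at y) z) / 2)"

definition cov_deriv :: "'e::euclidean_space metric \<Rightarrow> ('e \<Rightarrow> 'e) \<Rightarrow> 'e \<Rightarrow> 'e \<Rightarrow> 'e" where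
  "cov_deriv g X y v = frechet_derivative X (at y) v + christoffel g y v (X y)"

definition gradient :: "'e::euclidean_space metric \<Rightarrow> ('e \<Rightarrow> real) \<Rightarrow> 'e \<Rightarrow> 'e" where
  "gradient g f y = sharp g y (frechet_derivative f (at y))"

definition laplacian :: "'e::euclidean_space metric \<Rightarrow> ('e \<Rightarrow> real) \<Rightarrow> 'e \<Rightarrow> real" where
  "laplacian g f y = trace_op (cov_deriv g (gradient g f) y)"

text \<open>\<open>R(u,v)w = \<nabla>\<^sub>u \<nabla>\<^sub>v w - \<nabla>\<^sub>v \<nabla>\<^sub>u w\<close>; constant fields commute, so there is no bracket term.\<close>

definition curvature :: "'e::euclidean_space metric \<Rightarrow> 'e \<Rightarrow> 'e \<Rightarrow> 'e \<Rightarrow> 'e \<Rightarrow> 'e" where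
  "curvature g y u v w =
     cov_deriv g (\<lambda>x. christoffel g x v w) y u - cov_deriv g (\<lambda>x. christoffel g x u w) y v"

definition ricci :: "'e::euclidean_space metric \<Rightarrow> 'e \<Rightarrow> 'e \<Rightarrow> 'e \<Rightarrow> real" where
  "ricci g y v w = trace_op (\<lambda>u. curvature g y u v w)"

text \<open>The Leibniz formula for the determinant of the Gram matrix of the standard basis; the
  library's \<open>det\<close> is only available on types \<open>real ^ 'n ^ 'n\<close>.\<close>

definition vol_density :: "'e::euclidean_space metric \<Rightarrow> 'e \<Rightarrow> real" where
  "vol_density g y =
     sqrt (\<Sum>\<sigma> | \<sigma> permutes (Basis::'e set). of_int (sign \<sigma>) * (\<Prod>b\<in>Basis. g y b (\<sigma> b)))"


section \<open>Hypersurfaces of the unit sphere\<close>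

definition chart_deriv ::
  "('m \<Rightarrow> 'w::euclidean_space) \<Rightarrow> ('m, 'e::euclidean_space) chart \<Rightarrow> 'e \<Rightarrow> 'e \<Rightarrow> 'w" where
  "chart_deriv F c y = frechet_derivative (F \<circ> param c) (at y)"

definition induced_metric ::
  "('m \<Rightarrow> 'w::euclidean_space) \<Rightarrow> ('m, 'e::euclidean_space) chart \<Rightarrow> 'e metric" where
  "induced_metric F c y v w = chart_deriv F c y v \<bullet> chart_deriv F c y w"

text \<open>An isometrically immersed hypersurface of the unit sphere of \<open>'w\<close> (the manifold carries
  the induced metric), oriented by the unit normal field \<open>N\<close> tangent to the sphere.\<close>

definition oriented_hypersurface ::
  "('m::t2_space, 'e::euclidean_space) chart set \<Rightarrow> ('m \<Rightarrow> 'w::euclidean_space) \<Rightarrow> ('m \<Rightarrow> 'w) \<Rightarrow> bool" where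
  "oriented_hypersurface A F N \<longleftrightarrow>
     DIM('w) = DIM('e) + 2 \<and>
     smooth_atlas A \<and>
     smooth_map A (manifold A) F \<and>
     smooth_map A (manifold A) N \<and>
     (\<forall>p\<in>manifold A. norm (F p) = 1 \<and> norm (N p) = 1 \<and> N p \<bullet> F p = 0) \<and>
     (\<forall>c\<in>A. \<forall>y\<in>chart_cod c. inj (chart_deriv F c y) \<and>
        (\<forall>v. N (param c y) \<bullet> chart_deriv F c y v = 0))"

text \<open>\<open>A v = -(D\<^sub>v N)\<^sup>T\<close>, the tangential part being taken along the hypersurface.  Since the
  hypersurface lies in the sphere, the derivative of \<open>N\<close> in the sphere and the one in the ambient
  Euclidean space have the same tangential part.\<close>

definition shape_op ::
  "('m \<Rightarrow> 'w::euclidean_space) \<Rightarrow> ('m \<Rightarrow> 'w) \<Rightarrow> ('m, 'e::euclidean_space) chart \<Rightarrow> 'e \<Rightarrow> 'e \<Rightarrow> 'e" where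
  "shape_op F N c y v = sharp (induced_metric F c) y (\<lambda>w. - (chart_deriv N c y v \<bullet> chart_deriv F c y w))"

definition mean_curvature ::
  "('m \<Rightarrow> 'w::euclidean_space) \<Rightarrow> ('m \<Rightarrow> 'w) \<Rightarrow> ('m, 'e::euclidean_space) chart \<Rightarrow> 'e \<Rightarrow> real" where
  "mean_curvature F N c y = trace_op (shape_op F N c y) / DIM('e)"

text \<open>The squared norm \<open>tr (A\<^sup>* A)\<close> of the shape operator, the adjoint being taken with respect to
  the induced metric.\<close>

definition shape_norm2 ::
  "('m \<Rightarrow> 'w::euclidean_space) \<Rightarrow> ('m \<Rightarrow> 'w) \<Rightarrow> ('m, 'e::euclidean_space) chart \<Rightarrow> 'e \<Rightarrow> real" where
  "shape_norm2 F N c y = trace_op (\<lambda>v.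
     sharp (induced_metric F c) y
       (\<lambda>w. induced_metric F c y (shape_op F N c y v) (shape_op F N c y w)))"

definition minimal_at ::
  "('m, 'e::euclidean_space) chart set \<Rightarrow> ('m \<Rightarrow> 'w::euclidean_space) \<Rightarrow> ('m \<Rightarrow> 'w) \<Rightarrow> 'm \<Rightarrow> bool" where
  "minimal_at A F N p \<longleftrightarrow> (\<forall>c\<in>A. p \<in> chart_dom c \<longrightarrow> mean_curvature F N c (snd c p) = 0)"

definition minimal_hypersurface ::
  "('m::t2_space, 'e::euclidean_space) chart set \<Rightarrow> ('m \<Rightarrow> 'w::euclidean_space) \<Rightarrow> ('m \<Rightarrow> 'w) \<Rightarrow> bool" where
  "minimal_hypersurface A F N \<longleftrightarrow>
     oriented_hypersurface A F N \<and> (\<forall>p\<in>manifold A. minimal_at A F N p)"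

definition totally_geodesic ::
  "('m, 'e::euclidean_space) chart set \<Rightarrow> ('m \<Rightarrow> 'w::euclidean_space) \<Rightarrow> ('m \<Rightarrow> 'w) \<Rightarrow> bool" where
  "totally_geodesic A F N \<longleftrightarrow> (\<forall>c\<in>A. \<forall>y\<in>chart_cod c. \<forall>v. shape_op F N c y v = 0)"


section \<open>The ambient sphere\<close>

text \<open>Inverse stereographic projection from the pole \<open>P = (0, 1)\<close>.  It parametrises the unit
  sphere of \<open>'v \<times> real\<close> minus \<open>P\<close>, a point that the cones \<open>M \<times> (-\<pi>/2, 0]\<close> below avoid.\<close>

definition stereographic :: "'v::euclidean_space \<Rightarrow> 'v \<times> real" where
  "stereographic y =
     ((2 / (1 + (norm y)\<^sup>2)) *\<^sub>R y, ((norm y)\<^sup>2 - 1) / (1 + (norm y)\<^sup>2))"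

definition sphere_metric :: "'v::euclidean_space metric" where
  "sphere_metric y v w =
     frechet_derivative stereographic (at y) v \<bullet> frechet_derivative stereographic (at y) w"

text \<open>The Ricci tensor of the unit sphere of \<open>'v \<times> real\<close> at a point \<open>q\<close> other than \<open>P\<close>, evaluated
  on vectors \<open>v\<close>, \<open>w\<close> tangent to the sphere at \<open>q\<close>.\<close>

definition sphere_ricci ::
  "'v::euclidean_space \<times> real \<Rightarrow> 'v \<times> real \<Rightarrow> 'v \<times> real \<Rightarrow> real" where
  "sphere_ricci q v w =
     (let y = inv stereographic q;
          pull = inv (frechet_derivative stereographic (at y))
      in ricci sphere_metric y (pull v) (pull w))"

text \<open>A field \<open>V\<close> tangent to the unit sphere along a curve \<open>\<gamma>\<close> in the sphere is parallel iff its
  Euclidean derivative is normal to the sphere, that is, a multiple of \<open>\<gamma>\<close>.\<close>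

definition sphere_parallel :: "(real \<Rightarrow> 'w::euclidean_space) \<Rightarrow> (real \<Rightarrow> 'w) \<Rightarrow> real set \<Rightarrow> bool" where
  "sphere_parallel \<gamma> V S \<longleftrightarrow>
     (\<forall>s\<in>S. V s \<bullet> \<gamma> s = 0 \<and> (\<exists>k. (V has_vector_derivative k *\<^sub>R \<gamma> s) (at s within S)))"

definition parallel_transport :: "(real \<Rightarrow> 'w::euclidean_space) \<Rightarrow> real \<Rightarrow> real \<Rightarrow> 'w \<Rightarrow> 'w" where
  "parallel_transport \<gamma> a b v =
     (THE w. \<exists>V. sphere_parallel \<gamma> V (closed_segment a b) \<and> V a = v \<and> V b = w)"


section \<open>The cone\<close>

text \<open>\<open>\<real>\<^sup>n\<^sup>+\<^sup>3\<close> is \<open>'v \<times> real\<close> with \<open>'v\<close> in the role of \<open>\<real>\<^sup>n\<^sup>+\<^sup>2\<close>, and \<open>P = (0, 1)\<close>.\<close>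

definition cone_map :: "('m \<Rightarrow> 'v::euclidean_space) \<Rightarrow> 'm \<times> real \<Rightarrow> 'v \<times> real" where
  "cone_map \<phi> = (\<lambda>(p, t). cos t *\<^sub>R (\<phi> p, 0) + sin t *\<^sub>R (0, 1))"

text \<open>The product charts on \<open>M \<times> (-\<pi>/2, \<pi>/2)\<close>, an open manifold that contains the cone
  \<open>M \<times> (-\<pi>/2, 0]\<close> and the truncated cones \<open>M \<times> [-\<epsilon>, 0]\<close> as domains with boundary.\<close>

definition cone_chart :: "('m, 'e) chart \<Rightarrow> ('m \<times> real, 'e \<times> real) chart" where
  "cone_chart c = (chart_dom c \<times> {-(pi/2)<..<pi/2}, \<lambda>(p, t). (snd c p, t))"

definition cone_atlas :: "('m, 'e) chart set \<Rightarrow> ('m \<times> real, 'e \<times> real) chart set" where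
  "cone_atlas A = cone_chart ` A"

definition cone :: "('m, 'e) chart set \<Rightarrow> ('m \<times> real) set" where
  "cone A = manifold A \<times> {-(pi/2)<..0}"

definition truncated_cone :: "('m, 'e) chart set \<Rightarrow> real \<Rightarrow> ('m \<times> real) set" where
  "truncated_cone A \<epsilon> = manifold A \<times> {-\<epsilon>..0}"

definition truncated_cone_boundary :: "('m, 'e) chart set \<Rightarrow> real \<Rightarrow> ('m \<times> real) set" where
  "truncated_cone_boundary A \<epsilon> = manifold A \<times> {-\<epsilon>, 0}"

definition cone_normal ::
  "('m \<Rightarrow> 'v::euclidean_space) \<Rightarrow> ('m \<Rightarrow> 'v) \<Rightarrow> 'm \<times> real \<Rightarrow> 'v \<times> real" where
  "cone_normal \<phi> \<nu> = (\<lambda>(p, t). parallel_transport (\<lambda>s. cone_map \<phi> (p, s)) 0 t (\<nu> p, 0))"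

definition cone_minimal_hypersurface ::
  "('m::t2_space, 'e::euclidean_space) chart set \<Rightarrow> ('m \<Rightarrow> 'v::euclidean_space) \<Rightarrow> ('m \<Rightarrow> 'v) \<Rightarrow> bool" where
  "cone_minimal_hypersurface A \<phi> \<nu> \<longleftrightarrow>
     oriented_hypersurface (cone_atlas A) (cone_map \<phi>) (cone_normal \<phi> \<nu>) \<and>
     (\<forall>p\<in>cone A. minimal_at (cone_atlas A) (cone_map \<phi>) (cone_normal \<phi> \<nu>) p)"


section \<open>Integration and the index form\<close>

text \<open>A finite Borel partition of a compact manifold into relatively compact pieces of chart
  domains, each one paired with a chart.\<close>

definition cell_decomposition ::
  "('m::t2_space, 'e) chart set \<Rightarrow> (('m, 'e) chart \<times> 'm set) set \<Rightarrow> bool" where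
  "cell_decomposition A cells \<longleftrightarrow>
     finite cells \<and>
     (\<forall>(c, B)\<in>cells. c \<in> A \<and> B \<in> sets borel \<and> compact (closure B) \<and> closure B \<subseteq> chart_dom c) \<and>
     pairwise (\<lambda>(c, B) (d, B'). B \<inter> B' = {}) cells \<and>
     (\<Union>(c, B)\<in>cells. B) = manifold A"

text \<open>The integral over the union of the cells with respect to the Riemannian measure of the metric
  induced by \<open>F\<close>.  The integrand \<open>h\<close> is a scalar given by its expression \<open>h c\<close> in each chart \<open>c\<close>.\<close>

definition cell_integral ::
  "('m \<Rightarrow> 'w::euclidean_space) \<Rightarrow> (('m, 'e::euclidean_space) chart \<times> 'm set) set \<Rightarrow>
     (('m, 'e) chart \<Rightarrow> 'e \<Rightarrow> real) \<Rightarrow> real" where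
  "cell_integral F cells h =
     (\<Sum>(c, B)\<in>cells. set_lebesgue_integral lebesgue (snd c ` B)
        (\<lambda>y. h c y * vol_density (induced_metric F c) y))"

text \<open>Cells of a truncated cone; by the change of variables formula the integral does not depend on
  the decomposition chosen.\<close>

definition truncated_cone_cells ::
  "('m::t2_space, 'e) chart set \<Rightarrow> real \<Rightarrow> (('m \<times> real, 'e \<times> real) chart \<times> ('m \<times> real) set) set" where
  "truncated_cone_cells A \<epsilon> =
     (\<lambda>(c, B). (cone_chart c, B \<times> {-\<epsilon>..0})) ` (SOME cells. cell_decomposition A cells)"

definition index_form ::
  "('m::t2_space, 'e::euclidean_space) chart set \<Rightarrow> ('m \<Rightarrow> 'v::euclidean_space) \<Rightarrow> ('m \<Rightarrow> 'v) \<Rightarrow>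
     real \<Rightarrow> ('m \<times> real \<Rightarrow> real) \<Rightarrow> real" where
  "index_form A \<phi> \<nu> \<epsilon> G =
     (let F = cone_map \<phi>; N = cone_normal \<phi> \<nu> in
      cell_integral F (truncated_cone_cells A \<epsilon>) (\<lambda>c y.
        let p = param c y in
        - G p * laplacian (induced_metric F c) (G \<circ> param c) y
        - (sphere_ricci (F p) (N p) (N p) + shape_norm2 F N c y) * (G p)\<^sup>2))"

definition truncated_cone_unstable ::
  "('m::t2_space, 'e::euclidean_space) chart set \<Rightarrow> ('m \<Rightarrow> 'v::euclidean_space) \<Rightarrow> ('m \<Rightarrow> 'v) \<Rightarrow>
     real \<Rightarrow> bool" where
  "truncated_cone_unstable A \<phi> \<nu> \<epsilon> \<longleftrightarrow>
     (\<exists>G. smooth_map_on (cone_atlas A) (truncated_cone A \<epsilon>) G \<and>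
          (\<forall>p\<in>truncated_cone_boundary A \<epsilon>. G p = 0) \<and>
          index_form A \<phi> \<nu> \<epsilon> G < 0)"

definition cone_unstable ::
  "('m::t2_space, 'e::euclidean_space) chart set \<Rightarrow> ('m \<Rightarrow> 'v::euclidean_space) \<Rightarrow> ('m \<Rightarrow> 'v) \<Rightarrow> bool" where
  "cone_unstable A \<phi> \<nu> \<longleftrightarrow> (\<exists>\<epsilon>. 0 < \<epsilon> \<and> \<epsilon> < pi/2 \<and> truncated_cone_unstable A \<phi> \<nu> \<epsilon>)"

end

theory Submission
  imports Defs "Jordan_Normal_Form.Determinant"
begin

text \<open>On the cone, a function \<open>G\<close> of \<open>t\<close> alone has Laplacian \<open>G'' - n tan t G'\<close>, the Ricci term is
  \<open>n + 1\<close> and the squared norm of the shape operator is that of \<open>M\<close> divided by \<open>cos\<^sup>2 t\<close>.  If \<open>M\<close> were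
  totally geodesic, \<open>sin t\<close> would be a Jacobi field vanishing on the base.  The test function
  \<open>G = sin t - cos \<epsilon> tan t\<close> vanishes on both boundary components, and the part of \<open>I(G)\<close> not
  involving the shape operator of \<open>M\<close> is at most a constant times \<open>cos \<epsilon>\<close>.  The remaining part is
  \<open>- \<integral> \<bar>A\<bar>\<^sup>2 \<integral> G\<^sup>2 cos\<^sup>n\<^sup>-\<^sup>2 t dt\<close>, which stays below a negative constant as \<open>\<epsilon> \<rightarrow> \<pi>/2\<close>.  Because \<open>G\<close>
  does not depend on the point of \<open>M\<close>, Simons' estimate of the first eigenvalue of \<open>- \<Delta> - \<bar>A\<bar>\<^sup>2\<close> plays
  no role.\<close>

text \<open>For totally geodesic \<open>M\<close> the cone is part of a great sphere and
  \<open>sin t\<close> is a linear function restricted to it, so an eigenfunction of the Laplacian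
  for \<open>n + 1\<close>, which is exactly the Ricci term. It does not vanish near the vertex and
  has to be cut off at \<open>-\<epsilon>\<close>. Put
  \<open>L = - d^2/dt^2 + n tan t d/dt - (n + 1)\<close>. Then
  \<open>L tan t = tan t ((n - 2) / cos^2 t - (n + 1))\<close>, so
  \<open>G = sin t - c tan t\<close> satisfies \<open>G L G = c (sin^2 t / cos t) (1 - c / cos t)
  ((n + 1) - (n - 2) / cos^2 t)\<close>. The boundary condition forces
  \<open>c = cos \<epsilon>\<close>, which makes \<open>1 - c / cos t\<close> nonnegative on the
  truncated cone. For \<open>n >= 2\<close> the contribution most singular at the vertex is then
  nonpositive, and the weight \<open>cos^n t\<close> keeps the rest below \<open>c (n + 1)\<close>.
  The bound is pointwise in the integrand and hence applies in every cell of whichever decomposition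
  \<open>SOME\<close> selects. What must be found is one cell in which the second fundamental form
  is visible to the measure.\<close>

no_notation Matrix.scalar_prod (infix "\<bullet>" 70)


section \<open>Calculus of smooth functions\<close>

text \<open>\<open>frechet_derivative\<close> chooses from the set of derivatives. Equal sets give
  equal choices, so differentiability does not have to be known.\<close>

lemma frechet_derivative_eq_on_open:
  assumes "open S" "x \<in> S" "\<And>y. y \<in> S \<Longrightarrow> f y = g y"
  shows "frechet_derivative f (at x) = frechet_derivative g (at x)"
proof -
  have "(f has_derivative D) (at x) \<longleftrightarrow> (g has_derivative D) (at x)" for D
    using assms by (metis has_derivative_transform_within_open)
  then show ?thesis
    by (simp add: frechet_derivative_def)
qed

lemma Ck_on_SucD:
  assumes "Ck_on (Suc k) S f" "open S"
  shows "x \<in> S \<Longrightarrow> (f has_derivative frechet_derivative f (at x)) (at x)"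
    and "Ck_on k S (\<lambda>x. frechet_derivative f (at x) v)"
  using assms by (auto simp: differentiable_on_eq_differentiable_at frechet_derivative_works)

text \<open>Maps read in a chart take arbitrary values off \<open>chart_cod\<close>. This is what
  lets them be replaced by explicit formulas valid only there.\<close>

lemma Ck_on_cong:
  assumes "open S" "\<And>x. x \<in> S \<Longrightarrow> f x = g x"
  shows "Ck_on k S f \<longleftrightarrow> Ck_on k S g"
  using assms
proof (induction k arbitrary: f g)
  case 0
  then show ?case by (simp cong: continuous_on_cong)
next
  case (Suc k)
  have diff: "h' differentiable_on S" if "h differentiable_on S" "\<And>x. x \<in> S \<Longrightarrow> h x = h' x" for h h' :: "'a \<Rightarrow> 'b"
    unfolding differentiable_on_def
  proof
    fix x assume "x \<in> S"
    then show "h' differentiable at x within S"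
      by (intro differentiable_transform_within[of h x S 1 h'])
         (use that in \<open>auto simp: differentiable_on_def\<close>)
  qed
  have "f differentiable_on S \<longleftrightarrow> g differentiable_on S"
    using diff[of f g] diff[of g f] Suc.prems(2) by fastforce
  moreover have "Ck_on k S (\<lambda>x. frechet_derivative f (at x) v) \<longleftrightarrow>
      Ck_on k S (\<lambda>x. frechet_derivative g (at x) v)" for v
    by (rule Suc.IH[OF Suc.prems(1)])
       (simp add: frechet_derivative_eq_on_open[OF Suc.prems(1) _ Suc.prems(2)])
  ultimately show ?case by simp
qed

text \<open>Frees smoothness proofs from the chosen \<open>frechet_derivative\<close>: any formula
  for the derivative will do.\<close>

lemma Ck_on_SucI:
  assumes "open S" "\<And>x. x \<in> S \<Longrightarrow> (f has_derivative f' x) (at x)"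
    and "\<And>v. Ck_on k S (\<lambda>x. f' x v)"
  shows "Ck_on (Suc k) S f"
proof -
  have "f differentiable_on S"
    using assms(1,2) by (auto simp: differentiable_on_eq_differentiable_at differentiable_def)
  moreover have "Ck_on k S (\<lambda>x. frechet_derivative f (at x) v)" for v
    using assms(3)[of v] frechet_derivative_at[OF assms(2)]
    by (subst Ck_on_cong[OF assms(1), of _ "\<lambda>x. f' x v"]) auto
  ultimately show ?thesis by simp
qed

lemma Ck_on_Suc_imp: "Ck_on (Suc k) S f \<Longrightarrow> Ck_on k S f"
proof (induction k arbitrary: f)
  case 0
  then show ?case by (simp add: differentiable_imp_continuous_on)
next
  case (Suc k)
  have "Ck_on (Suc k) S (\<lambda>x. frechet_derivative f (at x) v)" for v
    using Suc.prems unfolding Ck_on.simps(2)[of "Suc k"] by blast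
  then have "Ck_on k S (\<lambda>x. frechet_derivative f (at x) v)" for v
    using Suc.IH by blast
  then show ?case using Suc.prems by simp
qed

text \<open>For a linear inner map, the derivative in direction \<open>v\<close> is a directional
  derivative of \<open>f\<close> again composed with \<open>L\<close>, so the induction closes. The
  coordinates of the cone are reached through the linear maps \<open>fst\<close> and
  \<open>snd\<close>.\<close>

lemma Ck_on_compose_linear:
  assumes "open S" "open T" "bounded_linear L" "L ` T \<subseteq> S" "Ck_on k S f"
  shows "Ck_on k T (\<lambda>x. f (L x))"
  using assms(5)
proof (induction k arbitrary: f)
  case 0
  then show ?case
    using assms(4) continuous_on_compose2[of S f T L]
      bounded_linear.continuous_on[OF assms(3) continuous_on_id] by simp
next
  case (Suc k)
  show ?case
  proof (rule Ck_on_SucI[OF assms(2)])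
    fix x assume "x \<in> T"
    then have "(f has_derivative frechet_derivative f (at (L x))) (at (L x))"
      using Ck_on_SucD(1)[OF Suc.prems assms(1)] assms(4) by blast
    then show "((\<lambda>x. f (L x)) has_derivative
        (\<lambda>v. frechet_derivative f (at (L x)) (L v))) (at x)"
      by (rule has_derivative_compose[OF bounded_linear_imp_has_derivative[OF assms(3)]])
  next
    fix v
    show "Ck_on k T (\<lambda>x. frechet_derivative f (at (L x)) (L v))"
      by (rule Suc.IH) (rule Ck_on_SucD(2)[OF Suc.prems assms(1)])
  qed
qed

lemma Ck_on_linear_compose:
  assumes "open S" "bounded_linear h" "Ck_on k S f"
  shows "Ck_on k S (\<lambda>x. h (f x))"
  using assms(3)
proof (induction k arbitrary: f)
  case 0
  then show ?case using assms by (auto intro: bounded_linear.continuous_on)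
next
  case (Suc k)
  show ?case
    by (rule Ck_on_SucI[OF assms(1) bounded_linear.has_derivative[OF assms(2)]])
       (use Suc assms(1) Ck_on_SucD in \<open>blast+\<close>)
qed

lemma Ck_on_const: "open S \<Longrightarrow> Ck_on k S (\<lambda>x. c)"
proof (induction k arbitrary: c)
  case (Suc k)
  then show ?case by (intro Ck_on_SucI[where f'="\<lambda>_ _. 0"]) auto
qed simp

lemma Ck_on_ident: "open S \<Longrightarrow> Ck_on k S (\<lambda>x. x)"
  by (cases k) (auto intro!: Ck_on_SucI[where f'="\<lambda>_ v. v"] Ck_on_const)

lemma Ck_on_add:
  assumes "open S" "Ck_on k S f" "Ck_on k S g"
  shows "Ck_on k S (\<lambda>x. f x + g x)"
  using assms(2,3)
proof (induction k arbitrary: f g)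
  case 0
  then show ?case by (auto intro: continuous_on_add)
next
  case (Suc k)
  show ?case
    by (rule Ck_on_SucI[OF assms(1) has_derivative_add])
       (use Suc assms(1) Ck_on_SucD in \<open>blast+\<close>)
qed

lemma Ck_on_bilinear:
  assumes "open S" "bounded_bilinear h" "Ck_on k S f" "Ck_on k S g"
  shows "Ck_on k S (\<lambda>x. h (f x) (g x))"
  using assms(3,4)
proof (induction k arbitrary: f g)
  case 0
  then show ?case using assms(2) by (auto intro: bounded_bilinear.continuous_on)
next
  case (Suc k)
  show ?case
  proof (rule Ck_on_SucI[OF assms(1) bounded_bilinear.FDERIV[OF assms(2)
          Ck_on_SucD(1)[OF Suc.prems(1) assms(1)] Ck_on_SucD(1)[OF Suc.prems(2) assms(1)]]])
    fix v
    show "Ck_on k S (\<lambda>x. h (f x) (frechet_derivative g (at x) v) +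
        h (frechet_derivative f (at x) v) (g x))"
      \<comment> \<open>In each summand of the product rule one factor is undifferentiated and has
        an order to spare, which \<open>Ck_on_Suc_imp\<close> gives away.\<close>
      by (rule Ck_on_add[OF assms(1) Suc.IH[OF Ck_on_Suc_imp Ck_on_SucD(2)]
            Suc.IH[OF Ck_on_SucD(2) Ck_on_Suc_imp]]) (fact Suc.prems assms(1))+
  qed
qed

lemma Ck_on_Pair:
  assumes "open S" "Ck_on k S f" "Ck_on k S g"
  shows "Ck_on k S (\<lambda>x. (f x, g x))"
proof -
  have "bounded_linear (\<lambda>y::'b. (y, 0::'c))" "bounded_linear (\<lambda>y::'c. (0::'b, y))"
    by (auto intro!: bounded_linear_Pair bounded_linear_ident bounded_linear_zero)
  then have "Ck_on k S (\<lambda>x. (f x, 0) + (0, g x))"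
    using Ck_on_add[OF assms(1) Ck_on_linear_compose[OF assms(1) _ assms(2)]
        Ck_on_linear_compose[OF assms(1) _ assms(3)]] by blast
  then show ?thesis by simp
qed

lemma Ck_on_mult_right: "open S \<Longrightarrow> Ck_on k S f \<Longrightarrow> Ck_on k S (\<lambda>x. f x * (v::real))"
  using Ck_on_linear_compose[OF _ bounded_linear_mult_left] by blast

text \<open>Each function is the derivative of the other up to sign, so the induction must carry
  both.\<close>

lemma Ck_on_sin_cos: "Ck_on k UNIV (sin :: real \<Rightarrow> real) \<and> Ck_on k UNIV (cos :: real \<Rightarrow> real)"
proof (induction k)
  case 0
  then show ?case by (auto intro: continuous_intros)
next
  case (Suc k)
  have "Ck_on (Suc k) UNIV (sin :: real \<Rightarrow> real)"
    by (rule Ck_on_SucI[where f'="\<lambda>x v. cos x * v"])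
       (use Suc in \<open>auto intro!: derivative_eq_intros Ck_on_mult_right\<close>)
  moreover have "Ck_on (Suc k) UNIV (cos :: real \<Rightarrow> real)"
    by (rule Ck_on_SucI[where f'="\<lambda>x v. - (sin x * v)"])
       (use Suc in \<open>auto intro!: derivative_eq_intros
          Ck_on_linear_compose[OF _ bounded_linear_minus[OF bounded_linear_mult_left]]\<close>)
  ultimately show ?case by blast
qed

text \<open>Writing the derivative as \<open>1 + tan x * tan x\<close> keeps it a polynomial in
  \<open>tan\<close>, to which the induction hypothesis applies.\<close>

lemma Ck_on_tan: "Ck_on k {-(pi/2)<..<pi/2} (tan :: real \<Rightarrow> real)"
proof (induction k)
  case 0
  have "cos x \<noteq> 0" if "x \<in> {-(pi/2)<..<pi/2}" for x :: real
    using cos_gt_zero_pi[of x] that by auto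
  then show ?case by (auto intro!: continuous_intros)
next
  case (Suc k)
  have c: "cos x \<noteq> 0" if "x \<in> {-(pi/2)<..<pi/2}" for x :: real
    using cos_gt_zero_pi[of x] that by auto
  show ?case
  proof (rule Ck_on_SucI[where f'="\<lambda>x v. (1 + tan x * tan x) * v"])
    show "(tan has_derivative (\<lambda>v. (1 + tan x * tan x) * v)) (at x)"
      if "x \<in> {-(pi/2)<..<pi/2}" for x :: real
      using DERIV_tan[OF c[OF that]] tan_sec[OF c[OF that]]
      by (simp add: has_field_derivative_def power2_eq_square)
  qed (use Suc in \<open>auto intro!: Ck_on_mult_right Ck_on_add Ck_on_const
        Ck_on_bilinear[OF _ bounded_bilinear_mult]\<close>)
qed


section \<open>Linear algebra of induced metrics\<close>

lemma trace_op_compose_commute: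
  fixes X :: "'a::euclidean_space \<Rightarrow> 'b::euclidean_space"
  assumes X: "linear X" and Y: "linear Y"
  shows "trace_op (\<lambda>x. X (Y x)) = trace_op (\<lambda>x. Y (X x))"
proof -
  have e: "P (Q x) \<bullet> z = (\<Sum>c\<in>Basis. (Q x \<bullet> c) * (P c \<bullet> z))"
    if "linear P" for P :: "'c::euclidean_space \<Rightarrow> 'd::euclidean_space" and Q :: "'d \<Rightarrow> 'c" and x z
  proof -
    have "P (Q x) = P (\<Sum>c\<in>Basis. (Q x \<bullet> c) *\<^sub>R c)"
      by (simp add: euclidean_representation)
    also have "\<dots> = (\<Sum>c\<in>Basis. (Q x \<bullet> c) *\<^sub>R P c)"
      by (simp add: linear_sum[OF that] linear_cmul[OF that])
    finally show ?thesis by (simp add: inner_sum_left)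
  qed
  show ?thesis
    unfolding trace_op_def e[OF X] e[OF Y] by (subst sum.swap) (simp add: mult.commute)
qed

text \<open>Polarization.\<close>

lemma inner_eq_if_norm_eq:
  assumes "linear f" "linear g" "\<And>x. norm (f x) = norm (g x)"
  shows "f v \<bullet> f w = g v \<bullet> g w"
proof -
  have "norm (f v + f w) = norm (g v + g w)"
    using assms(3)[of "v + w"] by (simp add: linear_add[OF assms(1)] linear_add[OF assms(2)])
  then show ?thesis by (simp add: dot_norm assms(3))
qed

text \<open>The range of \<open>J\<close> has the dimension of \<open>'e\<close>, so an isometry
  maps it onto \<open>'e\<close>; composing with \<open>J\<close> gives an automorphism
  \<open>K\<close> of the coordinate space with the same Gram form. Its inverse \<open>K'\<close>
  takes \<open>Basis\<close> to a frame orthonormal for that form.\<close>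

lemma isometric_frame:
  fixes J :: "'e::euclidean_space \<Rightarrow> 'w::euclidean_space"
  assumes J: "linear J" "inj J"
  obtains K K' :: "'e \<Rightarrow> 'e" where "linear K" "linear K'" "\<And>x. K (K' x) = x" "\<And>x. K' (K x) = x"
    "\<And>v w. K v \<bullet> K w = J v \<bullet> J w"
proof -
  have "dim (range J) = dim (UNIV :: 'e set)"
    using J by (simp add: dim_image_eq)
  then obtain f where f: "linear f" "\<And>x. x \<in> range J \<Longrightarrow> norm (f x) = norm x"
    and "f ` range J = (UNIV :: 'e set)"
    using isometries_subspaces[of "range J" "UNIV :: 'e set"] J(1)
    by (metis linear_subspace_image subspace_UNIV)
  define K where "K = f \<circ> J"
  have K: "linear K" unfolding K_def by (rule linear_compose[OF J(1) f(1)])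
  have norm: "norm (K x) = norm (J x)" for x using f(2) by (simp add: K_def)
  have "inj K"
    using norm J K by (metis linear_injective_0 norm_eq_zero)
  then obtain K' where K': "linear K'" "\<forall>x. K' (K x) = x" "\<forall>x. K (K' x) = x"
    using linear_injective_isomorphism[OF K] by blast
  show ?thesis
    by (rule that[OF K K'(1)]) (use K' inner_eq_if_norm_eq[OF K J(1) norm] in auto)
qed

lemma inner_image_cancel:
  assumes "linear J" "inj J" "\<And>w. J u \<bullet> J w = J v \<bullet> J w"
  shows "u = v"
proof -
  have "J (u - v) \<bullet> J (u - v) = 0"
    using assms(3)[of "u - v"] by (simp add: linear_diff[OF assms(1)] inner_diff_left)
  then show ?thesis
    using assms(1,2) by (metis eq_iff_diff_eq_0 inner_eq_zero_iff linear_injective_0)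
qed

text \<open>\<open>sharp\<close> is a definite description. The form is nondegenerate, so exhibiting
  one solution computes it.\<close>

lemma sharp_eqI:
  assumes "linear J" "inj J" "\<And>v w. g y v w = J v \<bullet> J w" "\<And>w. J u \<bullet> J w = l w"
  shows "sharp g y l = u"
  unfolding sharp_def
  by (rule the_equality) (use assms inner_image_cancel[OF assms(1,2)] in auto)

text \<open>Riesz representation for the form \<open>J v \<bullet> J w\<close>.\<close>

lemma inner_sharp:
  fixes J :: "'e::euclidean_space \<Rightarrow> 'w::euclidean_space"
  assumes "linear J" "inj J" "\<And>v w. g y v w = J v \<bullet> J w" and l: "linear l"
  shows "J (sharp g y l) \<bullet> J w = l w"
proof -
  obtain K K' :: "'e \<Rightarrow> 'e" where K: "\<And>x. K (K' x) = x" "\<And>x. K' (K x) = x"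
    "\<And>v w. K v \<bullet> K w = J v \<bullet> J w" and "linear K'"
    using isometric_frame[OF assms(1,2)] by metis
  \<comment> \<open>The coefficients are the values of \<open>l\<close> on the orthonormal frame
    \<open>K' b\<close>.\<close>
  define u where "u = K' (\<Sum>b\<in>Basis. l (K' b) *\<^sub>R b)"
  have "J u \<bullet> J w = l w" for w
  proof -
    have "l w = l (K' (\<Sum>b\<in>Basis. (K w \<bullet> b) *\<^sub>R b))"
      by (simp add: euclidean_representation K)
    also have "\<dots> = (\<Sum>b\<in>Basis. (K w \<bullet> b) * l (K' b))"
      by (simp add: linear_sum[OF \<open>linear K'\<close>] linear_sum[OF l] linear_cmul[OF \<open>linear K'\<close>]
          linear_cmul[OF l])
    also have "\<dots> = K u \<bullet> K w"
      by (simp add: u_def K inner_sum_left inner_commute[of "K w"] mult.commute)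
    finally show ?thesis by (simp add: K)
  qed
  then have "sharp g y l = u"
    by (intro sharp_eqI[where J=J] assms(1-3))
  then show ?thesis using \<open>\<And>w. J u \<bullet> J w = l w\<close> by simp
qed

text \<open>Operators defined through \<open>sharp\<close> are known only by their inner products;
  their linearity has to be read off from these.\<close>

lemma linear_if_inner_linear:
  assumes "linear J" "inj J" "\<And>z. linear (\<lambda>v. J (L v) \<bullet> J z)"
  shows "linear L"
proof (rule linearI)
  fix v w and r :: real
  show "L (v + w) = L v + L w"
    by (rule inner_image_cancel[OF assms(1,2)])
       (simp add: linear_add[OF assms(3)] linear_add[OF assms(1)] inner_add_left)
  show "L (r *\<^sub>R v) = r *\<^sub>R L v"
    by (rule inner_image_cancel[OF assms(1,2)])
       (simp add: linear_cmul[OF assms(3)] linear_cmul[OF assms(1)])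
qed

text \<open>In a basis orthonormal for the form \<open>J v \<bullet> J w\<close>, the trace of \<open>A\<^sup>* A\<close> is a sum of squares.\<close>

lemma trace_op_adjoint_square:
  fixes J :: "'e::euclidean_space \<Rightarrow> 'w::euclidean_space"
  assumes J: "linear J" "inj J" and A: "linear A"
    and L: "\<And>v w. J (L v) \<bullet> J w = J (A v) \<bullet> J (A w)"
  shows "0 \<le> trace_op L" and "trace_op L = 0 \<Longrightarrow> A v = 0"
proof -
  obtain K K' :: "'e \<Rightarrow> 'e" where K: "\<And>x. K (K' x) = x" "\<And>x. K' (K x) = x"
    "\<And>v w. K v \<bullet> K w = J v \<bullet> J w" and lin: "linear K" "linear K'"
    using isometric_frame[OF J] by metis
  have "linear L"
    by (rule linear_if_inner_linear[OF J])
       (auto simp: L intro!: linearI simp: linear_add[OF J(1)] linear_add[OF A] linear_cmul[OF J(1)]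
          linear_cmul[OF A] inner_add_left)
  then have "linear (\<lambda>x. K (L x))" using linear_compose[OF _ lin(1), of L] by (simp add: o_def)
  then have "trace_op (\<lambda>x. K' (K (L x))) = trace_op (\<lambda>x. K (L (K' x)))"
    using trace_op_compose_commute[OF lin(2)] by blast
  then have "trace_op L = trace_op (\<lambda>x. K (L (K' x)))" by (simp add: K)
  also have "\<dots> = (\<Sum>b\<in>Basis. K (L (K' b)) \<bullet> K (K' b))"
    by (simp add: trace_op_def K(1))
  also have "\<dots> = (\<Sum>b\<in>Basis. (norm (J (A (K' b))))\<^sup>2)"
    by (simp only: K(3) L power2_norm_eq_inner)
  finally have eq: "trace_op L = (\<Sum>b\<in>Basis. (norm (J (A (K' b))))\<^sup>2)" .
  then show "0 \<le> trace_op L" by (simp add: sum_nonneg)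
  assume "trace_op L = 0"
  then have "J (A (K' b)) = 0" if "b \<in> Basis" for b
    using that by (simp add: eq sum_nonneg_eq_0_iff)
  then have z: "A (K' b) = 0" if "b \<in> Basis" for b
    using that J by (metis linear_injective_0)
  have "A v = A (K' (\<Sum>b\<in>Basis. (K v \<bullet> b) *\<^sub>R b))"
    by (simp add: euclidean_representation K)
  also have "\<dots> = 0"
    by (simp add: linear_sum[OF lin(2)] linear_sum[OF A] linear_cmul[OF lin(2)] linear_cmul[OF A] z)
  finally show "A v = 0" .
qed

text \<open>Expanding \<open>u y\<close> in \<open>Basis\<close> reduces joint continuity to
  continuity in \<open>y\<close> at finitely many fixed vectors.\<close>

lemma continuous_on_linear_family:
  fixes J :: "'a::topological_space \<Rightarrow> 'e::euclidean_space \<Rightarrow> 'w::real_normed_vector"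
  assumes "\<And>y. y \<in> S \<Longrightarrow> linear (J y)" "\<And>v. continuous_on S (\<lambda>y. J y v)" "continuous_on S u"
  shows "continuous_on S (\<lambda>y. J y (u y))"
proof -
  have "J y (u y) = (\<Sum>b\<in>Basis. (u y \<bullet> b) *\<^sub>R J y b)" if "y \<in> S" for y
  proof -
    have "J y (u y) = J y (\<Sum>b\<in>Basis. (u y \<bullet> b) *\<^sub>R b)"
      by (simp add: euclidean_representation)
    then show ?thesis
      by (simp add: linear_sum[OF assms(1)[OF that]] linear_cmul[OF assms(1)[OF that]])
  qed
  then show ?thesis
    using assms(2,3) by (simp cong: continuous_on_cong) (intro continuous_intros)
qed

lemma abs_linear_le_sum_Basis:
  fixes l :: "'e::euclidean_space \<Rightarrow> real"
  assumes "linear l"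
  shows "\<bar>l w\<bar> \<le> (\<Sum>b\<in>Basis. \<bar>l b\<bar>) * norm w"
proof -
  have "l w = l (\<Sum>b\<in>Basis. (w \<bullet> b) *\<^sub>R b)" by (simp add: euclidean_representation)
  also have "\<dots> = (\<Sum>b\<in>Basis. (w \<bullet> b) * l b)" by (simp add: linear_sum[OF assms] linear_cmul[OF assms])
  finally have "\<bar>l w\<bar> \<le> (\<Sum>b\<in>Basis. \<bar>w \<bullet> b\<bar> * \<bar>l b\<bar>)"
    by (simp add: abs_mult[symmetric] sum_abs)
  also have "\<dots> \<le> (\<Sum>b\<in>Basis. norm w * \<bar>l b\<bar>)"
    by (intro sum_mono mult_right_mono Basis_le_norm) auto
  finally show ?thesis by (simp add: sum_distrib_left mult.commute)
qed

text \<open>The forms \<open>g y\<close> near \<open>y\<^sub>0\<close> inherit the coercivity constant of \<open>g y\<^sub>0\<close> up to a small error.\<close>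

lemma continuous_on_sharp:
  fixes J :: "'a::topological_space \<Rightarrow> 'e::euclidean_space \<Rightarrow> 'w::euclidean_space"
    and g :: "'a \<Rightarrow> 'e \<Rightarrow> 'e \<Rightarrow> real" and s :: "'a \<Rightarrow> 'e"
  assumes J: "\<And>y. y \<in> S \<Longrightarrow> linear (J y)" "\<And>y. y \<in> S \<Longrightarrow> inj (J y)"
    and contJ: "\<And>v. continuous_on S (\<lambda>y. J y v)"
    and l: "\<And>y. y \<in> S \<Longrightarrow> linear (l y)" "\<And>v. continuous_on S (\<lambda>y. l y v)"
    and s: "\<And>y w. y \<in> S \<Longrightarrow> J y (s y) \<bullet> J y w = l y w"
  shows "continuous_on S s"
proof -
  have "(s \<longlongrightarrow> s a) (at a within S)" if a: "a \<in> S" for a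
  proof -
    obtain m where m: "m > 0" "\<And>x. m * norm x \<le> norm (J a x)"
      using linear_inj_bounded_below_pos[OF J(1)[OF a] J(2)[OF a]] by blast
    \<comment> \<open>\<open>\<delta> y\<close> is the entrywise change of the Gram matrix between
      \<open>a\<close> and \<open>y\<close>, and \<open>\<rho> y\<close> measures how far
      \<open>s a\<close> is from solving the equation at \<open>y\<close>. Both tend to 0, and
      coercivity turns the defect \<open>\<rho> y\<close> into a bound on
      \<open>s y - s a\<close>.\<close>
    define \<delta> where "\<delta> y = (\<Sum>b\<in>Basis. \<Sum>c\<in>Basis. \<bar>J y b \<bullet> J y c - J a b \<bullet> J a c\<bar>)" for y
    define \<rho> where "\<rho> y = (\<Sum>b\<in>Basis. \<bar>l y b - J y (s a) \<bullet> J y b\<bar>)" for y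
    have limJ: "((\<lambda>y. J y v) \<longlongrightarrow> J a v) (at a within S)" for v
      using contJ a by (simp add: continuous_on_def)
    have liml: "((\<lambda>y. l y v) \<longlongrightarrow> l a v) (at a within S)" for v
      using l a by (simp add: continuous_on_def)
    have "(\<delta> \<longlongrightarrow> (\<Sum>b\<in>Basis. \<Sum>c\<in>Basis. \<bar>J a b \<bullet> J a c - J a b \<bullet> J a c\<bar>)) (at a within S)"
      unfolding \<delta>_def by (intro tendsto_intros limJ)
    then have \<delta>0: "(\<delta> \<longlongrightarrow> 0) (at a within S)" by simp
    have "(\<rho> \<longlongrightarrow> (\<Sum>b\<in>Basis. \<bar>l a b - J a (s a) \<bullet> J a b\<bar>)) (at a within S)"
      unfolding \<rho>_def by (intro tendsto_intros limJ liml)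
    then have \<rho>0: "(\<rho> \<longlongrightarrow> 0) (at a within S)" by (simp add: s[OF a])
    have bound: "norm (s y - s a) \<le> \<rho> y / (m\<^sup>2 - \<delta> y)" if y: "y \<in> S" "\<delta> y < m\<^sup>2" for y
    proof -
      define w where "w = s y - s a"
      have lin: "linear (\<lambda>v. l y v - J y (s a) \<bullet> J y v)" "linear (\<lambda>v. J y v \<bullet> J y w - J a v \<bullet> J a w)"
        "linear (\<lambda>w. J y v \<bullet> J y w - J a v \<bullet> J a w)" for v
        by (auto intro!: linearI simp: linear_add[OF l(1)[OF y(1)]] linear_cmul[OF l(1)[OF y(1)]]
            linear_add[OF J(1)[OF y(1)]] linear_cmul[OF J(1)[OF y(1)]] linear_add[OF J(1)[OF a]]
            linear_cmul[OF J(1)[OF a]] algebra_simps)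
      have "J y w \<bullet> J y w = l y w - J y (s a) \<bullet> J y w"
        using s[OF y(1), of w] by (simp add: w_def linear_diff[OF J(1)[OF y(1)]] inner_diff_left)
      also have "\<dots> \<le> \<rho> y * norm w"
        using abs_linear_le_sum_Basis[OF lin(1), of w] by (simp add: \<rho>_def)
      finally have 1: "J y w \<bullet> J y w \<le> \<rho> y * norm w" .
      have "\<bar>J y w \<bullet> J y w - J a w \<bullet> J a w\<bar> \<le> (\<Sum>b\<in>Basis. \<bar>J y b \<bullet> J y w - J a b \<bullet> J a w\<bar>) * norm w"
        using abs_linear_le_sum_Basis[OF lin(2), of w] by simp
      also have "\<dots> \<le> (\<Sum>b\<in>Basis. (\<Sum>c\<in>Basis. \<bar>J y b \<bullet> J y c - J a b \<bullet> J a c\<bar>) * norm w) * norm w"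
        by (intro mult_right_mono sum_mono abs_linear_le_sum_Basis[OF lin(3)]) auto
      also have "\<dots> = \<delta> y * (norm w)\<^sup>2"
        by (simp add: \<delta>_def sum_distrib_right power2_eq_square mult.assoc)
      finally have 2: "J a w \<bullet> J a w - \<delta> y * (norm w)\<^sup>2 \<le> J y w \<bullet> J y w" by linarith
      have "(m * norm w)\<^sup>2 \<le> (norm (J a w))\<^sup>2"
        using m by (intro power_mono) auto
      then have "(m\<^sup>2 - \<delta> y) * norm w * norm w \<le> \<rho> y * norm w"
        using 1 2 by (simp add: power2_norm_eq_inner[symmetric] power_mult_distrib algebra_simps power2_eq_square)
      then have "(m\<^sup>2 - \<delta> y) * norm w \<le> \<rho> y"
        by (cases "w = 0") (auto simp: \<rho>_def sum_nonneg)
      then show ?thesis using y(2) by (simp add: w_def field_simps)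
    qed
    have "\<forall>\<^sub>F y in at a within S. \<delta> y < m\<^sup>2"
      using order_tendstoD(2)[OF \<delta>0] m(1) by simp
    then have "\<forall>\<^sub>F y in at a within S. norm (s y - s a) \<le> \<rho> y / (m\<^sup>2 - \<delta> y)"
      by (auto simp: eventually_at_filter elim!: eventually_mono intro: bound)
    moreover have "((\<lambda>y. \<rho> y / (m\<^sup>2 - \<delta> y)) \<longlongrightarrow> 0) (at a within S)"
      using tendsto_divide[OF \<rho>0 tendsto_diff[OF tendsto_const[of "m\<^sup>2"] \<delta>0]] m(1) by simp
    ultimately have "((\<lambda>y. s y - s a) \<longlongrightarrow> 0) (at a within S)"
      by (rule Lim_null_comparison)
    then show ?thesis by (simp add: LIM_zero_iff)
  qed
  then show ?thesis by (simp add: continuous_on_def)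
qed

text \<open>The determinant over an arbitrary index set, so that Gram determinants over
  \<open>Basis\<close> of \<open>'e\<close>, over the product basis of the cone and over
  \<open>{0..<n}\<close> can be compared.\<close>

definition leibniz :: "'i set \<Rightarrow> ('i \<Rightarrow> 'i \<Rightarrow> real) \<Rightarrow> real" where
  "leibniz S m = (\<Sum>\<sigma> | \<sigma> permutes S. of_int (sign \<sigma>) * (\<Prod>b\<in>S. m b (\<sigma> b)))"

lemma vol_density_leibniz: "vol_density g y = sqrt (leibniz Basis (g y))"
  by (simp add: vol_density_def leibniz_def)

text \<open>Rows and columns are renamed together, so each permutation is conjugated by
  \<open>h\<close> and keeps its sign.\<close>

lemma leibniz_reindex:
  assumes h: "bij_betw h S T" and "finite S"
  shows "leibniz T m = leibniz S (\<lambda>i j. m (h i) (h j))"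
proof -
  note h' = bij_betw_inv_into[OF h]
  have inj: "inj_on h S" using h by (rule bij_betw_imp_inj_on)
  show ?thesis
    unfolding leibniz_def
  proof (rule sum.reindex_bij_witness[symmetric,
        of _ "map_permutation T (inv_into S h)" "map_permutation S h"])
    fix \<sigma> assume "\<sigma> \<in> {\<sigma>. \<sigma> permutes S}"
    then have \<sigma>: "\<sigma> permutes S" by simp
    show "map_permutation T (inv_into S h) (map_permutation S h \<sigma>) = \<sigma>"
      using inj by (intro map_permutation_compose_inv[OF h \<sigma>]) simp
    show "map_permutation S h \<sigma> \<in> {\<sigma>. \<sigma> permutes T}"
      using map_permutation_permutes[OF h \<sigma>] by simp
    have "(\<Prod>b\<in>T. m b (map_permutation S h \<sigma> b)) = (\<Prod>i\<in>S. m (h i) (h (\<sigma> i)))"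
      unfolding prod.reindex_bij_betw[OF h, symmetric]
      by (rule prod.cong) (auto simp: map_permutation_apply[OF inj])
    then show "of_int (sign (map_permutation S h \<sigma>)) * (\<Prod>b\<in>T. m b (map_permutation S h \<sigma> b)) =
        of_int (sign \<sigma>) * (\<Prod>i\<in>S. m (h i) (h (\<sigma> i)))"
      by (simp add: sign_map_permutation[OF inj \<sigma> assms(2)])
  next
    fix \<sigma> assume "\<sigma> \<in> {\<sigma>. \<sigma> permutes T}"
    then have \<sigma>: "\<sigma> permutes T" by simp
    show "map_permutation S h (map_permutation T (inv_into S h) \<sigma>) = \<sigma>"
      by (intro map_permutation_compose_inv[OF h' \<sigma>]) (rule bij_betw_inv_into_right[OF h])
    show "map_permutation T (inv_into S h) \<sigma> \<in> {\<sigma>. \<sigma> permutes S}"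
      using map_permutation_permutes[OF h' \<sigma>] by simp
  qed
qed

lemma leibniz_cong:
  assumes "\<And>i j. i \<in> S \<Longrightarrow> j \<in> S \<Longrightarrow> m i j = m' i j"
  shows "leibniz S m = leibniz S m'"
  unfolding leibniz_def
  by (intro sum.cong refl arg_cong2[where f="(*)"] prod.cong) (auto simp: assms permutes_in_image)

lemma leibniz_scale: "leibniz S (\<lambda>i j. r * m i j) = r ^ card S * leibniz S m"
  by (simp add: leibniz_def prod.distrib sum_distrib_left algebra_simps)

text \<open>Expansion along row \<open>a\<close>: a permutation that moves \<open>a\<close> picks a
  zero entry of that row, and the others are permutations of \<open>S\<close>.\<close>

lemma leibniz_insert:
  assumes "finite S" "a \<notin> S" "\<And>b. b \<in> S \<Longrightarrow> m a b = 0"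
  shows "leibniz (insert a S) m = m a a * leibniz S m"
proof -
  have "leibniz (insert a S) m =
      (\<Sum>\<sigma> | \<sigma> permutes S. of_int (sign \<sigma>) * (\<Prod>b\<in>insert a S. m b (\<sigma> b)))"
    unfolding leibniz_def
  proof (rule sum.mono_neutral_right)
    show "\<forall>\<sigma>\<in>{\<sigma>. \<sigma> permutes insert a S} - {\<sigma>. \<sigma> permutes S}.
        of_int (sign \<sigma>) * (\<Prod>b\<in>insert a S. m b (\<sigma> b)) = 0"
    proof
      fix \<sigma> assume \<sigma>: "\<sigma> \<in> {\<sigma>. \<sigma> permutes insert a S} - {\<sigma>. \<sigma> permutes S}"
      then have "\<sigma> a \<noteq> a"
        using permutes_superset[of \<sigma> "insert a S" S] by auto
      moreover have "\<sigma> a \<in> insert a S"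
        using \<sigma> permutes_in_image[of \<sigma> "insert a S" a] by simp
      ultimately have "m a (\<sigma> a) = 0" using assms(3) by blast
      then show "of_int (sign \<sigma>) * (\<Prod>b\<in>insert a S. m b (\<sigma> b)) = 0"
        using assms(1,2) by simp
    qed
  qed (use assms(1) in \<open>auto simp: finite_permutations intro: permutes_subset\<close>)
  also have "\<dots> = m a a * leibniz S m"
    using assms(1,2) by (simp add: leibniz_def sum_distrib_left permutes_not_in algebra_simps)
  finally show ?thesis .
qed

text \<open>With \<open>M\<close> the matrix of \<open>K\<close> in an enumerated basis, the Gram
  matrix is the transpose of \<open>M\<close> times \<open>M\<close>, with determinant the square of
  \<open>det M\<close>. A kernel vector of \<open>M\<close> would be the coordinate vector of some
  \<open>x\<close> with \<open>K x = 0\<close>, against injectivity.\<close>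

lemma leibniz_gram_pos:
  fixes K :: "'e::euclidean_space \<Rightarrow> 'e"
  assumes K: "linear K" "inj K"
  shows "leibniz Basis (\<lambda>b c. K b \<bullet> K c) > 0"
proof -
  define n where "n = DIM('e)"
  obtain h where h: "bij_betw h {0..<n} (Basis :: 'e set)"
    unfolding n_def using ex_bij_betw_nat_finite[OF finite_Basis] by blast
  define M where "M = mat n n (\<lambda>(i, j). K (h j) \<bullet> h i)"
  have M: "M \<in> carrier_mat n n" by (simp add: M_def)
  have "transpose_mat M * M = mat n n (\<lambda>(i, j). K (h i) \<bullet> K (h j))"
  proof (rule eq_matI)
    fix i j assume "i < dim_row (mat n n (\<lambda>(i, j). K (h i) \<bullet> K (h j)))"
      "j < dim_col (mat n n (\<lambda>(i, j). K (h i) \<bullet> K (h j)))"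
    then have ij: "i < n" "j < n" by auto
    then have "(transpose_mat M * M) $$ (i, j) = (\<Sum>k\<in>{0..<n}. (K (h i) \<bullet> h k) * (K (h j) \<bullet> h k))"
      by (simp add: M_def scalar_prod_def)
    also have "\<dots> = (\<Sum>b\<in>Basis. (K (h i) \<bullet> b) * (K (h j) \<bullet> b))"
      by (rule sum.reindex_bij_betw[OF h])
    finally show "(transpose_mat M * M) $$ (i, j) = mat n n (\<lambda>(i, j). K (h i) \<bullet> K (h j)) $$ (i, j)"
      using ij by (simp add: euclidean_inner[of "K (h i)" "K (h j)"])
  qed (auto simp: M_def)
  then have "det (transpose_mat M * M) = leibniz {0..<n} (\<lambda>i j. K (h i) \<bullet> K (h j))"
    by (simp add: det_def leibniz_def permutes_in_image)
  also have "\<dots> = leibniz Basis (\<lambda>b c. K b \<bullet> K c)"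
    using leibniz_reindex[OF h] by simp
  finally have "leibniz Basis (\<lambda>b c. K b \<bullet> K c) = det M * det M"
    using det_mult[OF _ M, of "transpose_mat M"] det_transpose[OF M] M by simp
  moreover have "det M \<noteq> 0"
  proof
    assume "det M = 0"
    then obtain v where v: "v \<in> carrier_vec n" "v \<noteq> 0\<^sub>v n" "M *\<^sub>v v = 0\<^sub>v n"
      using det_0_iff_vec_prod_zero[OF M] by blast
    define x where "x = (\<Sum>j\<in>{0..<n}. vec_index v j *\<^sub>R h j)"
    have "K x \<bullet> h i = 0" if "i < n" for i
    proof -
      have "K x \<bullet> h i = (\<Sum>j\<in>{0..<n}. (K (h j) \<bullet> h i) * vec_index v j)"
        by (simp add: x_def linear_sum[OF K(1)] linear_cmul[OF K(1)] inner_sum_left mult.commute)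
      also have "\<dots> = vec_index (M *\<^sub>v v) i"
        using that v(1) by (simp add: M_def scalar_prod_def)
      finally show ?thesis using v(3) that by simp
    qed
    then have "K x \<bullet> b = 0" if "b \<in> Basis" for b
      using that h by (metis atLeastLessThan_iff bij_betw_imp_surj_on imageE)
    then have "K x = 0" by (metis euclidean_all_zero_iff)
    then have x0: "x = 0" using K by (metis linear_injective_0)
    have "vec_index v i = 0" if "i < n" for i
    proof -
      have "h j \<bullet> h i = (if j = i then 1 else 0)" if "j \<in> {0..<n}" for j
        using h that \<open>i < n\<close> bij_betwE[OF h] bij_betw_imp_inj_on[OF h]
        by (auto simp: inner_Basis inj_on_eq_iff)
      then have "(\<Sum>j\<in>{0..<n}. vec_index v j * (h j \<bullet> h i)) = (\<Sum>j\<in>{0..<n}. if j = i then vec_index v j else 0)"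
        by (intro sum.cong) auto
      then have "x \<bullet> h i = (\<Sum>j\<in>{0..<n}. if j = i then vec_index v j else 0)"
        by (simp add: x_def inner_sum_left)
      then show ?thesis using x0 that by simp
    qed
    then have "v = 0\<^sub>v n" using v(1) by auto
    with v(2) show False ..
  qed
  ultimately show ?thesis by (simp add: zero_less_mult_iff) (metis linorder_neqE_linordered_idom)
qed

text \<open>\<open>J\<close> takes values in a possibly larger space, so its matrix need not be
  square; \<open>isometric_frame\<close> supplies an endomorphism with the same Gram form.\<close>

lemma vol_density_pos:
  fixes J :: "'e::euclidean_space \<Rightarrow> 'w::euclidean_space"
  assumes "linear J" "inj J" "\<And>v w. g y v w = J v \<bullet> J w"
  shows "vol_density g y > 0"
proof -
  obtain K K' :: "'e \<Rightarrow> 'e" where K: "linear K" "\<And>x. K' (K x) = x"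
    "\<And>v w. K v \<bullet> K w = J v \<bullet> J w"
    using isometric_frame[OF assms(1,2)] by metis
  moreover have "inj K" using K(2) by (metis injI)
  ultimately have "leibniz Basis (\<lambda>b c. J b \<bullet> J c) > 0"
    using leibniz_gram_pos[of K] by simp
  then show ?thesis using leibniz_cong[of Basis "g y" "\<lambda>b c. J b \<bullet> J c"] assms(3)
    by (simp add: vol_density_leibniz)
qed

text \<open>The \<open>real\<close> direction is orthogonal to \<open>'e\<close> and of unit length,
  so it splits off as a factor 1; scaling the remaining block by \<open>q\<close> yields one
  \<open>q\<close> per dimension.\<close>

lemma vol_density_warped:
  fixes g :: "'e::euclidean_space metric" and G :: "('e \<times> real) metric"
  assumes "\<And>v w s r. G z (v, s) (w, r) = q * g y v w + s * r"
    and "\<And>v. g y v 0 = 0" "\<And>v. g y 0 v = 0"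
  shows "vol_density G z = sqrt (q ^ DIM('e)) * vol_density g y"
proof -
  let ?S = "(\<lambda>b::'e. (b, 0::real)) ` Basis"
  have B: "(Basis :: ('e \<times> real) set) = insert (0, 1) ?S" by (auto simp: Basis_prod_def)
  have "leibniz Basis (G z) = G z (0, 1) (0, 1) * leibniz ?S (G z)"
    unfolding B by (rule leibniz_insert) (auto simp: assms)
  also have "leibniz ?S (G z) = leibniz Basis (\<lambda>b c. G z (b, 0) (c, 0))"
    by (rule leibniz_reindex) (auto simp: inj_on_def intro!: inj_on_imp_bij_betw)
  also have "\<dots> = q ^ DIM('e) * leibniz Basis (g y)"
    by (simp add: assms leibniz_scale)
  finally show ?thesis
    by (simp add: vol_density_leibniz assms real_sqrt_mult)
qed

lemma continuous_on_vol_density: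
  assumes "\<And>v w. continuous_on S (\<lambda>y. g y v w)"
  shows "continuous_on S (vol_density g)"
  unfolding vol_density_def[abs_def] by (intro continuous_intros assms)

lemma trace_op_prod:
  "trace_op (L :: 'e::euclidean_space \<times> real \<Rightarrow> 'e \<times> real) =
     trace_op (\<lambda>v. fst (L (v, 0))) + snd (L (0, 1))"
proof -
  have "trace_op L = (\<Sum>b\<in>Basis. L (b, 0) \<bullet> (b, 0)) + L (0, 1) \<bullet> (0, 1)"
    unfolding trace_op_def Basis_prod_def
    by (subst sum.union_disjoint) (auto simp: sum.reindex inj_on_def)
  then show ?thesis by (simp add: trace_op_def inner_prod_def)
qed


section \<open>The Ricci tensor of the sphere\<close>

lemma stereographic_has_derivative:
  fixes y :: "'v::euclidean_space"
  shows "(stereographic has_derivative (\<lambda>v.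
     ((2 / (1 + (norm y)\<^sup>2)) *\<^sub>R v - (4 * (y \<bullet> v) / (1 + (norm y)\<^sup>2)\<^sup>2) *\<^sub>R y,
      4 * (y \<bullet> v) / (1 + (norm y)\<^sup>2)\<^sup>2))) (at y)"
proof -
  have pos: "1 + y \<bullet> y \<noteq> 0" by (smt (verit) inner_ge_zero)
  \<comment> \<open>In this form both components depend on the same scalar
    \<open>2 / (1 + y \<bullet> y)\<close>, and one derivative serves both.\<close>
  have eq: "stereographic = (\<lambda>y::'v. ((2 / (1 + y \<bullet> y)) *\<^sub>R y, 1 - 2 / (1 + y \<bullet> y)))"
  proof
    fix x :: 'v
    have "1 + x \<bullet> x \<noteq> 0" by (smt (verit) inner_ge_zero)
    then show "stereographic x = ((2 / (1 + x \<bullet> x)) *\<^sub>R x, 1 - 2 / (1 + x \<bullet> x))"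
      by (simp add: stereographic_def power2_norm_eq_inner field_simps)
  qed
  have k: "((\<lambda>y::'v. 2 / (1 + y \<bullet> y)) has_derivative (\<lambda>v. - (4 * (y \<bullet> v) / (1 + y \<bullet> y)\<^sup>2))) (at y)"
    by (rule derivative_eq_intros | rule pos | rule refl)+
       (use pos in \<open>auto simp: fun_eq_iff field_simps power2_eq_square inner_commute\<close>)
  show ?thesis
    unfolding eq power2_norm_eq_inner
    by (rule derivative_eq_intros k | rule refl)+ (auto simp: fun_eq_iff algebra_simps)
qed

lemma sphere_metric_eq:
  "sphere_metric y v w = 4 / (1 + y \<bullet> y)\<^sup>2 * (v \<bullet> w)"
proof -
  define D where "D = 1 + y \<bullet> y"
  have pos: "D \<noteq> 0" unfolding D_def by (smt (verit) inner_ge_zero)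
  have q: "y \<bullet> y = D - 1" by (simp add: D_def)
  note d = frechet_derivative_at[OF stereographic_has_derivative, symmetric]
  \<comment> \<open>Working with the inverse \<open>k\<close> keeps the computation polynomial; the
    unwanted terms collect in a multiple of \<open>1 - k * D\<close>, which is 0.\<close>
  define k where "k = inverse D"
  have kD: "k * D = 1" using pos by (simp add: k_def)
  have "sphere_metric y v w =
     ((2 * k) *\<^sub>R v - (4 * (y \<bullet> v) * k\<^sup>2) *\<^sub>R y) \<bullet> ((2 * k) *\<^sub>R w - (4 * (y \<bullet> w) * k\<^sup>2) *\<^sub>R y)
     + (4 * (y \<bullet> v) * k\<^sup>2) * (4 * (y \<bullet> w) * k\<^sup>2)"
    unfolding sphere_metric_def d
    by (simp add: power2_norm_eq_inner D_def k_def divide_inverse power_inverse)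
  also have "\<dots> = 4 * k\<^sup>2 * (v \<bullet> w) - 16 * (y \<bullet> v) * (y \<bullet> w) * k^3 * (1 - k * D)"
    by (simp add: inner_diff_left inner_diff_right q inner_commute[of v y] algebra_simps
        eval_nat_numeral)
  finally show ?thesis
    unfolding kD by (simp add: D_def k_def divide_inverse power_inverse)
qed

lemma sharp_sphere_metric:
  assumes "\<And>w. 4 / (1 + y \<bullet> y)\<^sup>2 * (u \<bullet> w) = l w"
  shows "sharp sphere_metric y l = u"
  unfolding sharp_def
proof (rule the_equality)
  show "\<forall>w. sphere_metric y u w = l w"
    using assms by (simp add: sphere_metric_eq)
  fix x assume "\<forall>w. sphere_metric y x w = l w"
  then have "4 / (1 + y \<bullet> y)\<^sup>2 * (x \<bullet> w) = 4 / (1 + y \<bullet> y)\<^sup>2 * (u \<bullet> w)" for w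
    using assms by (simp add: sphere_metric_eq)
  moreover have "4 / (1 + y \<bullet> y)\<^sup>2 \<noteq> 0" by (smt (verit) divide_eq_0_iff inner_ge_zero zero_eq_power2)
  ultimately have "x \<bullet> w = u \<bullet> w" for w by (metis mult_cancel_left)
  then show "x = u" by (metis vector_eq_rdot)
qed

text \<open>The metric is conformal to the Euclidean one with factor \<open>e^(2f)\<close>,
  \<open>f = log (2 / (1 + |y|^2))\<close>, and this is the conformal formula
  \<open>df(v) w + df(w) v - (v \<bullet> w) grad f\<close>.\<close>

lemma christoffel_sphere_metric:
  "christoffel sphere_metric y v w =
     (- 2 / (1 + y \<bullet> y)) *\<^sub>R ((y \<bullet> v) *\<^sub>R w + (y \<bullet> w) *\<^sub>R v - (v \<bullet> w) *\<^sub>R y)"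
proof -
  have pos: "1 + x \<bullet> x \<noteq> 0" for x :: 'a by (smt (verit) inner_ge_zero)
  have k: "((\<lambda>x. sphere_metric x v w) has_derivative
     (\<lambda>u. - 16 * (y \<bullet> u) / (1 + y \<bullet> y)^3 * (v \<bullet> w))) (at y)" for v w :: 'a
    unfolding sphere_metric_eq divide_inverse power_inverse[symmetric]
    by (rule derivative_eq_intros | rule refl | simp add: pos)+
       (auto simp: fun_eq_iff eval_nat_numeral inner_commute)
  note k' = frechet_derivative_at[OF k, symmetric]
  have e: "4 / D\<^sup>2 * (- 2 / D * X) = - 8 * X / D^3" for D X :: real
    by (simp add: eval_nat_numeral)
  show ?thesis
    unfolding christoffel_def k'
    by (rule sharp_sphere_metric, unfold inner_scaleR_left e)
       (simp add: inner_diff_left inner_add_left inner_commute algebra_simps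
         add_divide_distrib diff_divide_distrib)
qed

text \<open>Constant curvature 1: the scalar factor turns the Euclidean inner products into
  \<open>sphere_metric\<close>.\<close>

lemma curvature_sphere_metric:
  "curvature sphere_metric y u v w =
     (4 / (1 + y \<bullet> y)\<^sup>2) *\<^sub>R ((v \<bullet> w) *\<^sub>R u - (u \<bullet> w) *\<^sub>R v)"
proof -
  define D where "D = 1 + y \<bullet> y"
  have pos: "1 + y \<bullet> y \<noteq> 0" by (smt (verit) inner_ge_zero)
  have q: "y \<bullet> y = D - 1" by (simp add: D_def)
  have D: "D \<noteq> 0" using pos by (simp add: D_def)
  have k: "((\<lambda>x. christoffel sphere_metric x v w) has_derivative (\<lambda>u.
      (4 * (y \<bullet> u) / D\<^sup>2) *\<^sub>R ((y \<bullet> v) *\<^sub>R w + (y \<bullet> w) *\<^sub>R v - (v \<bullet> w) *\<^sub>R y)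
      + (- 2 / D) *\<^sub>R ((u \<bullet> v) *\<^sub>R w + (u \<bullet> w) *\<^sub>R v - (v \<bullet> w) *\<^sub>R u))) (at y)" for v w
  proof -
    have "((\<lambda>x. - 2 / (1 + x \<bullet> x)) has_derivative (\<lambda>u. 4 * (y \<bullet> u) / D\<^sup>2)) (at y)"
      unfolding D_def
      by (rule derivative_eq_intros | rule pos | rule refl)+
         (use pos in \<open>auto simp: fun_eq_iff field_simps power2_eq_square inner_commute\<close>)
    moreover have "((\<lambda>x. (x \<bullet> v) *\<^sub>R w + (x \<bullet> w) *\<^sub>R v - (v \<bullet> w) *\<^sub>R x) has_derivative
        (\<lambda>u. (u \<bullet> v) *\<^sub>R w + (u \<bullet> w) *\<^sub>R v - (v \<bullet> w) *\<^sub>R u)) (at y)"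
      by (rule derivative_eq_intros | rule refl)+ (auto simp: fun_eq_iff)
    ultimately show ?thesis
      unfolding christoffel_sphere_metric
      by (rule has_derivative_eq_rhs[OF has_derivative_scaleR])
         (simp add: fun_eq_iff D_def add.commute)
  qed
  \<comment> \<open>The first two summands differentiate the coefficient and the bracket; the last
    one is \<open>christoffel\<close> applied to \<open>christoffel\<close>.\<close>
  have cd: "cov_deriv sphere_metric (\<lambda>x. christoffel sphere_metric x v w) y u =
      (4 * (y \<bullet> u) / D\<^sup>2) *\<^sub>R ((y \<bullet> v) *\<^sub>R w + (y \<bullet> w) *\<^sub>R v - (v \<bullet> w) *\<^sub>R y)
      + (- 2 / D) *\<^sub>R ((u \<bullet> v) *\<^sub>R w + (u \<bullet> w) *\<^sub>R v - (v \<bullet> w) *\<^sub>R u)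
      + (4 / D\<^sup>2) *\<^sub>R ((y \<bullet> u) *\<^sub>R ((y \<bullet> v) *\<^sub>R w + (y \<bullet> w) *\<^sub>R v - (v \<bullet> w) *\<^sub>R y)
         + (2 * (y \<bullet> v) * (y \<bullet> w) - (v \<bullet> w) * (y \<bullet> y)) *\<^sub>R u
         - ((y \<bullet> v) * (u \<bullet> w) + (y \<bullet> w) * (u \<bullet> v) - (v \<bullet> w) * (y \<bullet> u)) *\<^sub>R y)" for u v
    unfolding cov_deriv_def frechet_derivative_at[OF k, symmetric]
    unfolding christoffel_sphere_metric[of y u]
    by (simp add: christoffel_sphere_metric D_def[symmetric] inner_diff_right inner_add_right
        inner_commute[of u y] algebra_simps power2_eq_square)
  \<comment> \<open>After antisymmetrization the bracket contributes \<open>4 / D\<close> and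
    everything else \<open>- 4 / D\<^sup>2 * (y \<bullet> y)\<close>; they merge because
    \<open>D - y \<bullet> y = 1\<close>.\<close>
  have k: "4 / D = 4 / D\<^sup>2 * (1 + y \<bullet> y)"
    using D by (simp add: q power2_eq_square)
  have "curvature sphere_metric y u v w \<bullet> z = (4 / D\<^sup>2) *\<^sub>R ((v \<bullet> w) *\<^sub>R u - (u \<bullet> w) *\<^sub>R v) \<bullet> z" for z
  proof -
    have "curvature sphere_metric y u v w \<bullet> z =
        4 / D * ((v \<bullet> w) * (u \<bullet> z) - (u \<bullet> w) * (v \<bullet> z))
        - 4 / D\<^sup>2 * (y \<bullet> y) * ((v \<bullet> w) * (u \<bullet> z) - (u \<bullet> w) * (v \<bullet> z))"
      by (simp add: curvature_def cd inner_diff_left inner_add_left inner_commute[of v u]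
          algebra_simps)
    then show ?thesis
      unfolding k by (simp add: inner_diff_left algebra_simps add_divide_distrib diff_divide_distrib)
  qed
  then show ?thesis
    unfolding D_def by (metis vector_eq_rdot)
qed

lemma ricci_sphere_metric:
  "ricci sphere_metric y v w = (real DIM('v::euclidean_space) - 1) * sphere_metric y v (w::'v)"
proof -
  have "(\<Sum>b\<in>Basis. (v \<bullet> w) * (b \<bullet> b) - (b \<bullet> w) * (v \<bullet> b)) = (real DIM('v) - 1) * (v \<bullet> w)"
    by (simp add: sum_subtractf sum_distrib_left[symmetric] euclidean_inner[of v w]
        mult.commute algebra_simps inner_commute)
  then have "(4 / (1 + y \<bullet> y)\<^sup>2) * (\<Sum>b\<in>Basis. (v \<bullet> w) * (b \<bullet> b) - (b \<bullet> w) * (v \<bullet> b)) =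
      (real DIM('v) - 1) * sphere_metric y v w"
    by (simp add: sphere_metric_eq)
  then show ?thesis
    by (simp only: ricci_def trace_op_def curvature_sphere_metric inner_scaleR_left inner_diff_left
        sum_distrib_left)
qed

text \<open>The last coordinate determines the norm, and then the first determines the point.
  Injectivity lets \<open>inv stereographic\<close> in \<open>sphere_ricci\<close> be
  evaluated.\<close>

lemma inj_stereographic: "inj stereographic"
proof (rule injI)
  fix x y :: "'v::euclidean_space"
  assume "stereographic x = stereographic y"
  then have a: "(2 / (1 + (norm x)\<^sup>2)) *\<^sub>R x = (2 / (1 + (norm y)\<^sup>2)) *\<^sub>R y"
    and "((norm x)\<^sup>2 - 1) / (1 + (norm x)\<^sup>2) = ((norm y)\<^sup>2 - 1) / (1 + (norm y)\<^sup>2)"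
    by (auto simp: stereographic_def)
  moreover have "1 + (norm x)\<^sup>2 > 0" "1 + (norm y)\<^sup>2 > 0" by (smt (verit) zero_le_power2)+
  ultimately have "(norm x)\<^sup>2 = (norm y)\<^sup>2"
    by (simp add: field_simps)
  then have "(2 / (1 + (norm y)\<^sup>2)) *\<^sub>R x = (2 / (1 + (norm y)\<^sup>2)) *\<^sub>R y" using a by simp
  then show "x = y" using \<open>1 + (norm y)\<^sup>2 > 0\<close> by simp
qed

text \<open>The point \<open>(a, s)\<close> is the image of \<open>a / (1 - s)\<close> under stereographic projection.\<close>

lemma sphere_ricci_horizontal:
  fixes a \<nu> :: "'v::euclidean_space"
  assumes s: "a \<bullet> a + s\<^sup>2 = 1" "s < 1" and \<nu>: "\<nu> \<bullet> \<nu> = 1" "\<nu> \<bullet> a = 0"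
  shows "sphere_ricci (a, s) (\<nu>, 0) (\<nu>, 0) = real DIM('v) - 1"
proof -
  define y where "y = (1 / (1 - s)) *\<^sub>R a"
  have "y \<bullet> y = (1 - s\<^sup>2) / (1 - s)\<^sup>2"
    using s(1) by (simp add: y_def power2_eq_square algebra_simps)
  also have "\<dots> = (1 + s) / (1 - s)"
  proof -
    have "1 - s\<^sup>2 = (1 + s) * (1 - s)" by (simp add: power2_eq_square algebra_simps)
    then show ?thesis by (simp add: power2_eq_square)
  qed
  finally have q: "1 + y \<bullet> y = 2 / (1 - s)" using s(2) by (simp add: field_simps)
  have "y \<bullet> y - 1 = 2 * s / (1 - s)"
    using q s(2) by (simp add: field_simps)
  then have st: "stereographic y = (a, s)"
    unfolding stereographic_def power2_norm_eq_inner q using s(2) by (simp add: y_def)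
  then have inv: "inv_into UNIV stereographic (a, s) = y"
    using inj_stereographic by (metis inv_f_f)
  let ?d = "frechet_derivative stereographic (at y)"
  note d = frechet_derivative_at[OF stereographic_has_derivative, symmetric, of y]
  have y\<nu>: "y \<bullet> \<nu> = 0" using \<nu>(2) by (simp add: y_def inner_commute)
  have du: "?d ((1 / (1 - s)) *\<^sub>R \<nu>) = (\<nu>, 0)"
    unfolding d power2_norm_eq_inner q using s(2) y\<nu> by simp
  \<comment> \<open>\<open>?d\<close> maps into a larger space, so its \<open>inv\<close> is
    meaningful only on the range, where injectivity makes it return the preimage found in
    \<open>du\<close>.\<close>
  have "inj ?d"
  proof (rule injI)
    fix v w assume eq: "?d v = ?d w"
    then have "y \<bullet> v = y \<bullet> w"
      unfolding d power2_norm_eq_inner q using s(2) by simp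
    then show "v = w"
      using eq unfolding d power2_norm_eq_inner q using s(2) by simp
  qed
  then have "inv_into UNIV ?d (\<nu>, 0) = (1 / (1 - s)) *\<^sub>R \<nu>"
    using du by (metis inv_f_f)
  then show ?thesis
    unfolding sphere_ricci_def inv Let_def
    using s(2) \<nu>(1) by (simp add: ricci_sphere_metric sphere_metric_eq q power2_eq_square)
qed


section \<open>Charts and immersed hypersurfaces\<close>

abbreviation open_time :: "real set" where
  "open_time \<equiv> {-(pi/2)<..<pi/2}"

lemma smooth_atlas_chart:
  assumes "smooth_atlas A" "c \<in> A"
  shows open_chart_dom: "open (chart_dom c)" and open_chart_cod: "open (chart_cod c)"
    and param_in_dom: "\<And>y. y \<in> chart_cod c \<Longrightarrow> param c y \<in> chart_dom c"
    and chart_param: "\<And>y. y \<in> chart_cod c \<Longrightarrow> snd c (param c y) = y"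
    and param_chart: "\<And>p. p \<in> chart_dom c \<Longrightarrow> param c (snd c p) = p"
    and continuous_chart: "continuous_on (chart_dom c) (snd c)"
    and continuous_param: "continuous_on (chart_cod c) (param c)"
    and inj_on_chart: "inj_on (snd c) (chart_dom c)"
proof -
  have h: "homeomorphism (chart_dom c) (chart_cod c) (snd c) (param c)"
    using assms unfolding smooth_atlas_def by blast
  show "open (chart_dom c)" "open (chart_cod c)"
    using assms unfolding smooth_atlas_def by blast+
  show "\<And>y. y \<in> chart_cod c \<Longrightarrow> param c y \<in> chart_dom c"
    "\<And>y. y \<in> chart_cod c \<Longrightarrow> snd c (param c y) = y"
    by (auto intro: inv_into_into f_inv_into_f)
  show *: "\<And>p. p \<in> chart_dom c \<Longrightarrow> param c (snd c p) = p"
    using h unfolding homeomorphism_def by blast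
  show "continuous_on (chart_dom c) (snd c)" "continuous_on (chart_cod c) (param c)"
    using h unfolding homeomorphism_def by blast+
  show "inj_on (snd c) (chart_dom c)" by (metis * inj_onI)
qed

lemma chart_image_eq:
  assumes "smooth_atlas A" "c \<in> A"
  shows "snd c ` (chart_dom c \<inter> U) = {y \<in> chart_cod c. param c y \<in> U}"
  using param_chart[OF assms] by force

lemma open_chart_image:
  assumes "smooth_atlas A" "c \<in> A" "open U"
  shows "open (snd c ` (chart_dom c \<inter> U))"
proof -
  have "{y \<in> chart_cod c. param c y \<in> U} = chart_cod c \<inter> param c -` U" by auto
  then show ?thesis
    using continuous_open_preimage[OF continuous_param[OF assms(1,2)] open_chart_cod[OF assms(1,2)] assms(3)]
    by (simp add: chart_image_eq[OF assms(1,2)])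
qed

lemma smooth_map_chart:
  assumes "smooth_map A (manifold A) f" "c \<in> A"
  shows "Ck_on k (chart_cod c) (\<lambda>y. f (param c y))"
proof -
  have "chart_dom c \<inter> manifold A = chart_dom c" using assms(2) by (auto simp: manifold_def)
  then have "smooth_on (chart_cod c) (f \<circ> param c)"
    using assms unfolding smooth_map_def by metis
  then show ?thesis by (simp add: smooth_on_def o_def)
qed

lemma smooth_map_has_derivative:
  assumes "smooth_atlas A" "smooth_map A (manifold A) f" "c \<in> A" "y \<in> chart_cod c"
  shows "((\<lambda>y. f (param c y)) has_derivative chart_deriv f c y) (at y)"
  using Ck_on_SucD(1)[OF smooth_map_chart[OF assms(2,3), of "Suc 0"] open_chart_cod[OF assms(1,3)] assms(4)]
  by (simp add: chart_deriv_def o_def)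

lemma Ck_on_chart_deriv:
  assumes "smooth_atlas A" "smooth_map A (manifold A) f" "c \<in> A"
  shows "Ck_on k (chart_cod c) (\<lambda>y. chart_deriv f c y v)"
  using Ck_on_SucD(2)[OF smooth_map_chart[OF assms(2,3), of "Suc k"] open_chart_cod[OF assms(1,3)]]
  by (simp add: chart_deriv_def o_def)

lemma cone_chart_dom: "chart_dom (cone_chart c) = chart_dom c \<times> open_time"
  by (simp add: cone_chart_def)

lemma cone_chart_cod: "chart_cod (cone_chart c) = chart_cod c \<times> open_time"
  by (force simp: cone_chart_def)

lemma cone_chart_apply: "snd (cone_chart c) (p, t) = (snd c p, t)"
  by (simp add: cone_chart_def)

lemma param_cone_chart:
  assumes "smooth_atlas A" "c \<in> A" "y \<in> chart_cod c" "t \<in> open_time"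
  shows "param (cone_chart c) (y, t) = (param c y, t)"
proof (rule inv_into_f_eq)
  show "inj_on (snd (cone_chart c)) (chart_dom (cone_chart c))"
    using inj_on_chart[OF assms(1,2)] by (auto simp: cone_chart_def inj_on_def)
  show "(param c y, t) \<in> chart_dom (cone_chart c)"
    using assms param_in_dom[OF assms(1-3)] by (simp add: cone_chart_dom)
  show "snd (cone_chart c) (param c y, t) = (y, t)"
    using chart_param[OF assms(1-3)] by (simp add: cone_chart_apply)
qed

lemma smooth_atlas_cone_atlas:
  assumes A: "smooth_atlas A"
  shows "smooth_atlas (cone_atlas A)"
proof -
  have chart: "open (chart_dom (cone_chart c)) \<and> open (chart_cod (cone_chart c)) \<and>
      homeomorphism (chart_dom (cone_chart c)) (chart_cod (cone_chart c))
        (snd (cone_chart c)) (param (cone_chart c))" if c: "c \<in> A" for c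
  proof (intro conjI homeomorphismI)
    show "open (chart_dom (cone_chart c))" "open (chart_cod (cone_chart c))"
      unfolding cone_chart_cod unfolding cone_chart_dom
      by (intro open_Times open_chart_dom[OF A c] open_chart_cod[OF A c]; simp)+
    have "continuous_on (chart_dom c \<times> open_time) (\<lambda>x. (snd c (fst x), snd x))"
      by (intro continuous_intros continuous_on_compose2[OF continuous_chart[OF A c]]) auto
    then show "continuous_on (chart_dom (cone_chart c)) (snd (cone_chart c))"
      by (simp add: cone_chart_def split_beta')
    have "continuous_on (chart_cod c \<times> open_time) (\<lambda>x. (param c (fst x), snd x))"
      by (intro continuous_intros continuous_on_compose2[OF continuous_param[OF A c]]) auto
    moreover have "continuous_on (chart_cod c \<times> open_time) (param (cone_chart c)) \<longleftrightarrow>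
        continuous_on (chart_cod c \<times> open_time) (\<lambda>x. (param c (fst x), snd x))"
      by (rule continuous_on_cong) (auto simp: param_cone_chart[OF A c])
    ultimately show "continuous_on (chart_cod (cone_chart c)) (param (cone_chart c))"
      by (simp add: cone_chart_cod)
    show "param (cone_chart c) ` chart_cod (cone_chart c) \<subseteq> chart_dom (cone_chart c)"
      by (blast intro: inv_into_into)
    show "param (cone_chart c) (snd (cone_chart c) x) = x" if "x \<in> chart_dom (cone_chart c)" for x
    proof -
      obtain p t where x: "x = (p, t)" "p \<in> chart_dom c" "t \<in> open_time"
        using \<open>x \<in> chart_dom (cone_chart c)\<close> by (auto simp: cone_chart_dom)
      then show ?thesis
        using param_cone_chart[OF A c, of "snd c p" t] param_chart[OF A c x(2)]
        by (simp add: cone_chart_apply)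
    qed
    show "snd (cone_chart c) (param (cone_chart c) y) = y" if "y \<in> chart_cod (cone_chart c)" for y
      using that by (rule f_inv_into_f)
  qed simp_all
  have trans: "smooth_on (snd (cone_chart c) ` (chart_dom (cone_chart c) \<inter> chart_dom (cone_chart d)))
      (snd (cone_chart d) \<circ> param (cone_chart c))" if c: "c \<in> A" and d: "d \<in> A" for c d
    unfolding smooth_on_def
  proof
    fix k
    let ?S = "snd c ` (chart_dom c \<inter> chart_dom d)"
    have S: "open ?S" using open_chart_image[OF A c open_chart_dom[OF A d]] .
    have ST: "open (?S \<times> open_time)" using S by (intro open_Times) auto
    have eq: "snd (cone_chart c) ` (chart_dom (cone_chart c) \<inter> chart_dom (cone_chart d)) = ?S \<times> open_time"
      by (force simp: cone_chart_def)
    have "Ck_on k ?S (\<lambda>y. snd d (param c y))"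
      using A c d unfolding smooth_atlas_def smooth_on_def by (auto simp: o_def)
    then have "Ck_on k (?S \<times> open_time) (\<lambda>x. snd d (param c (fst x)))"
      using Ck_on_compose_linear[OF S ST bounded_linear_fst, of k "\<lambda>y. snd d (param c y)"]
      by fastforce
    moreover have "Ck_on k (?S \<times> open_time) snd"
      by (rule Ck_on_linear_compose[OF ST bounded_linear_snd Ck_on_ident[OF ST]])
    ultimately have C: "Ck_on k (?S \<times> open_time) (\<lambda>x. (snd d (param c (fst x)), snd x))"
      by (rule Ck_on_Pair[OF ST])
    have E: "(snd d (param c (fst x)), snd x) = (snd (cone_chart d) \<circ> param (cone_chart c)) x"
      if "x \<in> ?S \<times> open_time" for x
    proof -
      have "fst x \<in> chart_cod c" "snd x \<in> open_time" using that by auto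
      then show ?thesis
        using param_cone_chart[OF A c, of "fst x" "snd x"] by (simp add: cone_chart_apply)
    qed
    show "Ck_on k (snd (cone_chart c) ` (chart_dom (cone_chart c) \<inter> chart_dom (cone_chart d)))
        (snd (cone_chart d) \<circ> param (cone_chart c))"
      unfolding eq using C Ck_on_cong[OF ST E] by (simp only:)
  qed
  show ?thesis
    unfolding smooth_atlas_def cone_atlas_def ball_simps
    by (rule conjI; intro ballI; (erule chart | erule (1) trans))
qed

lemma trace_op_scaleR: "trace_op (\<lambda>v. k *\<^sub>R L v) = k * trace_op L"
  by (simp add: trace_op_def sum_distrib_left)

lemma trace_op_ident: "trace_op (\<lambda>v::'e::euclidean_space. v) = DIM('e)"
  by (simp add: trace_op_def)

section \<open>An immersed hypersurface of the sphere, read in its charts\<close>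

locale oriented_immersion =
  fixes A :: "('m::t2_space, 'e::euclidean_space) chart set"
    and \<phi> \<nu> :: "'m \<Rightarrow> 'v::euclidean_space"
  assumes hypersurface: "oriented_hypersurface A \<phi> \<nu>"
begin

lemma atlas: "smooth_atlas A"
  and smooth_\<phi>: "smooth_map A (manifold A) \<phi>"
  and smooth_\<nu>: "smooth_map A (manifold A) \<nu>"
  and DIM: "DIM('v) = DIM('e) + 2"
  using hypersurface by (auto simp: oriented_hypersurface_def)

lemma unit: "p \<in> manifold A \<Longrightarrow> \<phi> p \<bullet> \<phi> p = 1" "p \<in> manifold A \<Longrightarrow> \<nu> p \<bullet> \<nu> p = 1"
  and normal: "p \<in> manifold A \<Longrightarrow> \<nu> p \<bullet> \<phi> p = 0"
  using hypersurface by (auto simp: oriented_hypersurface_def norm_eq_1)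

lemma param_in_manifold: "c \<in> A \<Longrightarrow> y \<in> chart_cod c \<Longrightarrow> param c y \<in> manifold A"
  unfolding manifold_def using param_in_dom[OF atlas] by blast

lemmas deriv_\<phi> = smooth_map_has_derivative[OF atlas smooth_\<phi>]
  and deriv_\<nu> = smooth_map_has_derivative[OF atlas smooth_\<nu>]

lemma linear_deriv:
  assumes "c \<in> A" "y \<in> chart_cod c"
  shows "linear (chart_deriv \<phi> c y)" "linear (chart_deriv \<nu> c y)"
  using deriv_\<phi>[OF assms] deriv_\<nu>[OF assms] has_derivative_linear by blast+

lemma inj_deriv: "c \<in> A \<Longrightarrow> y \<in> chart_cod c \<Longrightarrow> inj (chart_deriv \<phi> c y)"
  and deriv_normal: "c \<in> A \<Longrightarrow> y \<in> chart_cod c \<Longrightarrow> \<nu> (param c y) \<bullet> chart_deriv \<phi> c y v = 0"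
  using hypersurface by (auto simp: oriented_hypersurface_def)

text \<open>Differentiate the constants \<open>\<phi> \<bullet> \<phi> = 1\<close> and
  \<open>\<nu> \<bullet> \<phi> = 0\<close>; in the second, the term with the derivative of
  \<open>\<phi>\<close> vanishes because \<open>\<nu>\<close> is normal to \<open>M\<close>.\<close>

lemma deriv_tangent:
  assumes c: "c \<in> A" "y \<in> chart_cod c"
  shows "chart_deriv \<phi> c y v \<bullet> \<phi> (param c y) = 0" "chart_deriv \<nu> c y v \<bullet> \<phi> (param c y) = 0"
proof -
  have const: "D v = 0"
    if "(f has_derivative D) (at y)" "\<And>x. x \<in> chart_cod c \<Longrightarrow> f x = k"
    for f D and k :: real
  proof -
    have "(f has_derivative (\<lambda>_. 0)) (at y)"
      by (rule has_derivative_transform_within_open[OF has_derivative_const open_chart_cod[OF atlas c(1)] c(2)])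
         (use that in auto)
    then show ?thesis using that(1) has_derivative_unique by metis
  qed
  note m = param_in_manifold[OF c(1)]
  show "chart_deriv \<phi> c y v \<bullet> \<phi> (param c y) = 0"
    using const[OF has_derivative_inner[OF deriv_\<phi>[OF c] deriv_\<phi>[OF c]], of 1] unit m
    by (simp add: inner_commute)
  show "chart_deriv \<nu> c y v \<bullet> \<phi> (param c y) = 0"
    using const[OF has_derivative_inner[OF deriv_\<nu>[OF c] deriv_\<phi>[OF c]], of 0] normal m
      deriv_normal[OF c, of v] by simp
qed

lemma inner_shape_op:
  assumes "c \<in> A" "y \<in> chart_cod c"
  shows "chart_deriv \<phi> c y (shape_op \<phi> \<nu> c y v) \<bullet> chart_deriv \<phi> c y w =
    - (chart_deriv \<nu> c y v \<bullet> chart_deriv \<phi> c y w)"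
  unfolding shape_op_def
  by (rule inner_sharp[OF linear_deriv(1)[OF assms] inj_deriv[OF assms]])
     (auto simp: induced_metric_def linear_add[OF linear_deriv(1)[OF assms]]
       linear_cmul[OF linear_deriv(1)[OF assms]] inner_add_right intro!: linearI)

lemma linear_shape_op:
  assumes "c \<in> A" "y \<in> chart_cod c"
  shows "linear (shape_op \<phi> \<nu> c y)"
  by (rule linear_if_inner_linear[OF linear_deriv(1)[OF assms] inj_deriv[OF assms]])
     (auto simp: inner_shape_op[OF assms] linear_add[OF linear_deriv(2)[OF assms]]
       linear_cmul[OF linear_deriv(2)[OF assms]] inner_add_left intro!: linearI)

text \<open>The operator \<open>A\<^sup>* A\<close>, whose trace is
  \<open>shape_norm2\<close>.\<close>

definition shape_square :: "('m, 'e) chart \<Rightarrow> 'e \<Rightarrow> 'e \<Rightarrow> 'e" where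
  "shape_square c y v = sharp (induced_metric \<phi> c) y
     (\<lambda>w. induced_metric \<phi> c y (shape_op \<phi> \<nu> c y v) (shape_op \<phi> \<nu> c y w))"

lemma inner_shape_square:
  assumes "c \<in> A" "y \<in> chart_cod c"
  shows "chart_deriv \<phi> c y (shape_square c y v) \<bullet> chart_deriv \<phi> c y w =
    chart_deriv \<phi> c y (shape_op \<phi> \<nu> c y v) \<bullet> chart_deriv \<phi> c y (shape_op \<phi> \<nu> c y w)"
  unfolding shape_square_def
  by (subst inner_sharp[OF linear_deriv(1)[OF assms] inj_deriv[OF assms]])
     (auto simp: induced_metric_def linear_add[OF linear_deriv(1)[OF assms]]
       linear_cmul[OF linear_deriv(1)[OF assms]] linear_add[OF linear_shape_op[OF assms]]
       linear_cmul[OF linear_shape_op[OF assms]] inner_add_right intro!: linearI)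

lemma shape_norm2_eq: "shape_norm2 \<phi> \<nu> c y = trace_op (shape_square c y)"
  by (simp add: shape_norm2_def shape_square_def[abs_def])

lemma shape_norm2_nonneg: "c \<in> A \<Longrightarrow> y \<in> chart_cod c \<Longrightarrow> 0 \<le> shape_norm2 \<phi> \<nu> c y"
  and shape_norm2_zero: "c \<in> A \<Longrightarrow> y \<in> chart_cod c \<Longrightarrow> shape_norm2 \<phi> \<nu> c y = 0 \<Longrightarrow>
    shape_op \<phi> \<nu> c y v = 0"
  using trace_op_adjoint_square[OF linear_deriv(1) inj_deriv linear_shape_op inner_shape_square]
  by (auto simp: shape_norm2_eq)

lemma continuous_deriv:
  assumes "c \<in> A"
  shows "continuous_on (chart_cod c) (\<lambda>y. chart_deriv \<phi> c y v)"
    "continuous_on (chart_cod c) (\<lambda>y. chart_deriv \<nu> c y v)"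
  using Ck_on_chart_deriv[OF atlas smooth_\<phi> assms, of 0] Ck_on_chart_deriv[OF atlas smooth_\<nu> assms, of 0]
  by auto

text \<open>Needed twice: for integrability on the cells, and for openness of the set where the
  second fundamental form does not vanish.\<close>

lemma continuous_shape_norm2:
  assumes c: "c \<in> A"
  shows "continuous_on (chart_cod c) (shape_norm2 \<phi> \<nu> c)"
proof -
  note lin = linear_deriv[OF c] linear_shape_op[OF c]
  note cont = continuous_deriv[OF c]
  have 1: "continuous_on (chart_cod c) (\<lambda>y. shape_op \<phi> \<nu> c y v)" for v
    by (rule continuous_on_sharp[where J="chart_deriv \<phi> c" and
          l="\<lambda>y w. - (chart_deriv \<nu> c y v \<bullet> chart_deriv \<phi> c y w)"])
       (auto intro!: lin inj_deriv[OF c] cont continuous_intros inner_shape_op[OF c] linearI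
          simp: linear_add[OF lin(1)] linear_cmul[OF lin(1)] inner_add_right)
  have 2: "continuous_on (chart_cod c) (\<lambda>y. chart_deriv \<phi> c y (shape_op \<phi> \<nu> c y v))" for v
    by (rule continuous_on_linear_family[OF lin(1) cont(1) 1])
  have "continuous_on (chart_cod c) (\<lambda>y. shape_square c y v)" for v
    by (rule continuous_on_sharp[where J="chart_deriv \<phi> c" and
          l="\<lambda>y w. chart_deriv \<phi> c y (shape_op \<phi> \<nu> c y v) \<bullet> chart_deriv \<phi> c y (shape_op \<phi> \<nu> c y w)"])
       (auto intro!: lin inj_deriv[OF c] cont continuous_intros inner_shape_square[OF c] linearI 2
          simp: linear_add[OF lin(1)] linear_cmul[OF lin(1)] linear_add[OF lin(3)] linear_cmul[OF lin(3)]
            inner_add_right)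
  then show ?thesis
    unfolding shape_norm2_eq trace_op_def by (intro continuous_intros)
qed

lemma continuous_vol_density:
  "c \<in> A \<Longrightarrow> continuous_on (chart_cod c) (vol_density (induced_metric \<phi> c))"
  unfolding induced_metric_def[abs_def]
  by (intro continuous_on_vol_density continuous_intros continuous_deriv)

lemma induced_vol_density_pos:
  "c \<in> A \<Longrightarrow> y \<in> chart_cod c \<Longrightarrow> vol_density (induced_metric \<phi> c) y > 0"
  by (rule vol_density_pos[OF linear_deriv(1) inj_deriv]) (auto simp: induced_metric_def)

text \<open>A parallel field along \<open>t \<mapsto> \<Phi>(p, t)\<close> has the same derivative as its difference from the
  constant field \<open>(\<nu> p, 0)\<close>, and that difference is orthogonal to its own derivative.\<close>

lemma cone_normal_eq:
  assumes p: "p \<in> manifold A"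
  shows "cone_normal \<phi> \<nu> (p, t) = (\<nu> p, 0)"
proof -
  define \<gamma> where "\<gamma> s = cone_map \<phi> (p, s)" for s
  have orth: "(\<nu> p, 0) \<bullet> \<gamma> s = 0" for s
    using normal[OF p] by (simp add: \<gamma>_def cone_map_def)
  have unique: "V t = (\<nu> p, 0)"
    if par: "sphere_parallel \<gamma> V (closed_segment 0 t)" and V0: "V 0 = (\<nu> p, 0)" for V
  proof -
    let ?D = "\<lambda>s. V s - (\<nu> p, 0)"
    have d: "((\<lambda>s. ?D s \<bullet> ?D s) has_derivative (\<lambda>_. 0)) (at s within closed_segment 0 t)"
      if s: "s \<in> closed_segment 0 t" for s
    proof -
      obtain k where "(V has_vector_derivative k *\<^sub>R \<gamma> s) (at s within closed_segment 0 t)"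
        and "V s \<bullet> \<gamma> s = 0"
        using par s unfolding sphere_parallel_def by blast
      then have "(?D has_derivative (\<lambda>h. h *\<^sub>R k *\<^sub>R \<gamma> s)) (at s within closed_segment 0 t)"
        and o: "?D s \<bullet> \<gamma> s = 0"
        using orth by (auto simp: has_vector_derivative_def inner_diff_left intro!: derivative_eq_intros)
      from has_derivative_inner[OF this(1,1)] show ?thesis
        by (rule has_derivative_eq_rhs) (use o in \<open>simp add: fun_eq_iff inner_commute\<close>)
    qed
    obtain r where r: "\<And>s. s \<in> closed_segment 0 t \<Longrightarrow> ?D s \<bullet> ?D s = r"
      using has_derivative_zero_constant[OF convex_closed_segment d] by blast
    then have "?D t \<bullet> ?D t = ?D 0 \<bullet> ?D 0" by simp
    then show ?thesis using V0 by simp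
  qed
  have "sphere_parallel \<gamma> (\<lambda>_. (\<nu> p, 0)) (closed_segment 0 t)"
    unfolding sphere_parallel_def using orth
    by (auto intro!: exI[of _ 0] derivative_eq_intros)
  then have "parallel_transport \<gamma> 0 t (\<nu> p, 0) = (\<nu> p, 0)"
    unfolding parallel_transport_def using unique
    by (intro the_equality) (blast | metis)+
  then show ?thesis by (simp add: cone_normal_def \<gamma>_def[abs_def])
qed

end


section \<open>Geometry of the cone\<close>

context oriented_immersion
begin

text \<open>The differential of \<open>(y, t) \<mapsto> (cos t \<phi>, sin t)\<close>; its second
  component is the one along the pole \<open>P\<close>.\<close>

definition cone_deriv :: "('m, 'e) chart \<Rightarrow> 'e \<times> real \<Rightarrow> 'e \<times> real \<Rightarrow> 'v \<times> real" where
  "cone_deriv c z h = (cos (snd z) *\<^sub>R chart_deriv \<phi> c (fst z) (fst h)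
     - (snd h * sin (snd z)) *\<^sub>R \<phi> (param c (fst z)), snd h * cos (snd z))"

lemma open_cone_cod: "c \<in> A \<Longrightarrow> open (chart_cod c \<times> open_time)"
  using open_chart_cod[OF atlas] by (intro open_Times) auto

lemma cos_pos: "t \<in> open_time \<Longrightarrow> 0 < cos t"
  using cos_gt_zero_pi[of t] by simp

lemma cone_map_param:
  assumes "c \<in> A" "z \<in> chart_cod c \<times> open_time"
  shows "cone_map \<phi> (param (cone_chart c) z) =
    (cos (snd z) *\<^sub>R \<phi> (param c (fst z)), sin (snd z))"
  using assms by (auto simp: param_cone_chart[OF atlas] cone_map_def)

lemma cone_normal_param:
  assumes "c \<in> A" "z \<in> chart_cod c \<times> open_time"
  shows "cone_normal \<phi> \<nu> (param (cone_chart c) z) = (\<nu> (param c (fst z)), 0)"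
  using assms by (auto simp: param_cone_chart[OF atlas] cone_normal_eq param_in_manifold)

lemma Ck_on_fst:
  assumes "c \<in> A" "Ck_on k (chart_cod c) f"
  shows "Ck_on k (chart_cod c \<times> open_time) (\<lambda>z. f (fst z))"
  by (rule Ck_on_compose_linear[OF open_chart_cod[OF atlas assms(1)] open_cone_cod[OF assms(1)]
        bounded_linear_fst _ assms(2)]) auto

lemma Ck_on_snd:
  assumes "c \<in> A" "open T" "open_time \<subseteq> T" "Ck_on k T f"
  shows "Ck_on k (chart_cod c \<times> open_time) (\<lambda>z. f (snd z))"
  by (rule Ck_on_compose_linear[OF assms(2) open_cone_cod[OF assms(1)] bounded_linear_snd _ assms(4)])
     (use assms(3) in auto)

lemma Ck_on_cone_map:
  assumes c: "c \<in> A"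
  shows "Ck_on k (chart_cod (cone_chart c)) (\<lambda>z. cone_map \<phi> (param (cone_chart c) z))"
proof -
  have "Ck_on k (chart_cod c \<times> open_time) (\<lambda>z. (cos (snd z) *\<^sub>R \<phi> (param c (fst z)), sin (snd z)))"
    by (intro Ck_on_Pair Ck_on_bilinear[OF _ bounded_bilinear_scaleR] open_cone_cod[OF c]
        Ck_on_snd[OF c open_UNIV] Ck_on_fst[OF c] Ck_on_sin_cos[THEN conjunct1]
        Ck_on_sin_cos[THEN conjunct2] smooth_map_chart[OF smooth_\<phi> c]) auto
  then show ?thesis
    unfolding cone_chart_cod using Ck_on_cong[OF open_cone_cod[OF c] cone_map_param[OF c]] by (simp only:)
qed

lemma Ck_on_cone_normal:
  assumes c: "c \<in> A"
  shows "Ck_on k (chart_cod (cone_chart c)) (\<lambda>z. cone_normal \<phi> \<nu> (param (cone_chart c) z))"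
proof -
  have "Ck_on k (chart_cod c \<times> open_time) (\<lambda>z. (\<nu> (param c (fst z)), 0))"
    by (intro Ck_on_Pair open_cone_cod[OF c] Ck_on_fst[OF c] smooth_map_chart[OF smooth_\<nu> c]
        Ck_on_const)
  then show ?thesis
    unfolding cone_chart_cod using Ck_on_cong[OF open_cone_cod[OF c] cone_normal_param[OF c]] by (simp only:)
qed

lemma chart_deriv_cone_map:
  assumes c: "c \<in> A" and z: "z \<in> chart_cod c \<times> open_time"
  shows "chart_deriv (cone_map \<phi>) (cone_chart c) z = cone_deriv c z"
proof -
  have y: "fst z \<in> chart_cod c" using z by auto
  have "((\<lambda>z. (cos (snd z) *\<^sub>R \<phi> (param c (fst z)), sin (snd z))) has_derivative cone_deriv c z) (at z)"
    unfolding cone_deriv_def[abs_def]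
    by (rule has_derivative_compose[OF has_derivative_fst[OF has_derivative_ident] deriv_\<phi>[OF c y]]
        derivative_eq_intros refl)+ (simp add: fun_eq_iff algebra_simps)
  then have "((cone_map \<phi> \<circ> param (cone_chart c)) has_derivative cone_deriv c z) (at z)"
    by (rule has_derivative_transform_within_open[OF _ open_cone_cod[OF c] z])
       (simp add: cone_map_param[OF c])
  then show ?thesis
    unfolding chart_deriv_def by (metis frechet_derivative_at)
qed

lemma chart_deriv_cone_normal:
  assumes c: "c \<in> A" and z: "z \<in> chart_cod c \<times> open_time"
  shows "chart_deriv (cone_normal \<phi> \<nu>) (cone_chart c) z h = (chart_deriv \<nu> c (fst z) (fst h), 0)"
proof -
  have y: "fst z \<in> chart_cod c" using z by auto
  have "((\<lambda>z. (\<nu> (param c (fst z)), 0::real)) has_derivative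
      (\<lambda>h. (chart_deriv \<nu> c (fst z) (fst h), 0))) (at z)"
    by (rule has_derivative_compose[OF has_derivative_fst[OF has_derivative_ident] deriv_\<nu>[OF c y]]
        derivative_eq_intros refl)+
  then have "((cone_normal \<phi> \<nu> \<circ> param (cone_chart c)) has_derivative
      (\<lambda>h. (chart_deriv \<nu> c (fst z) (fst h), 0))) (at z)"
    by (rule has_derivative_transform_within_open[OF _ open_cone_cod[OF c] z])
       (simp add: cone_normal_param[OF c])
  then show ?thesis
    unfolding chart_deriv_def by (metis frechet_derivative_at)
qed

text \<open>The warped product metric \<open>dt^2 + cos^2 t g\<close>. Mixed terms vanish since
  \<open>\<phi>\<close> is orthogonal to its derivative, and the radial vector has squared length
  \<open>sin^2 t + cos^2 t\<close>.\<close>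

lemma inner_cone_deriv:
  assumes c: "c \<in> A" and z: "z \<in> chart_cod c \<times> open_time"
  shows "cone_deriv c z h \<bullet> cone_deriv c z k =
    (cos (snd z))\<^sup>2 * induced_metric \<phi> c (fst z) (fst h) (fst k) + snd h * snd k"
proof -
  have y: "fst z \<in> chart_cod c" using z by auto
  have "snd h * snd k * (sin (snd z))\<^sup>2 + snd h * snd k * (cos (snd z))\<^sup>2 = snd h * snd k"
    by (simp add: distrib_left[symmetric])
  then show ?thesis
    using deriv_tangent(1)[OF c y] unit(1)[OF param_in_manifold[OF c y]]
    by (simp add: cone_deriv_def induced_metric_def inner_diff_left inner_diff_right
        inner_commute[of "\<phi> (param c (fst z))" "chart_deriv _ _ _ _"] power2_eq_square algebra_simps)
qed

lemma induced_metric_cone: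
  assumes "c \<in> A" "z \<in> chart_cod c \<times> open_time"
  shows "induced_metric (cone_map \<phi>) (cone_chart c) z h k =
    (cos (snd z))\<^sup>2 * induced_metric \<phi> c (fst z) (fst h) (fst k) + snd h * snd k"
  using assms by (simp add: induced_metric_def[of "cone_map \<phi>"] chart_deriv_cone_map inner_cone_deriv)

lemma linear_cone_deriv:
  assumes "c \<in> A" "z \<in> chart_cod c \<times> open_time"
  shows "linear (cone_deriv c z)"
proof -
  have "fst z \<in> chart_cod c" using assms by auto
  note l = linear_deriv(1)[OF assms(1) this]
  show ?thesis
    by (rule linearI) (auto simp: cone_deriv_def linear_add[OF l] linear_cmul[OF l] algebra_simps)
qed

lemma inj_cone_deriv:
  assumes c: "c \<in> A" and z: "z \<in> chart_cod c \<times> open_time"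
  shows "inj (cone_deriv c z)"
proof -
  have y: "fst z \<in> chart_cod c" and cos: "cos (snd z) \<noteq> 0" using z cos_pos[of "snd z"] by auto
  have "h = 0" if "cone_deriv c z h = 0" for h
  proof -
    have h: "snd h = 0" using that cos by (simp add: cone_deriv_def zero_prod_def)
    then have "chart_deriv \<phi> c (fst z) (fst h) = 0"
      using that cos by (simp add: cone_deriv_def zero_prod_def)
    then have "fst h = 0"
      using linear_deriv(1)[OF c y] inj_deriv[OF c y] by (metis linear_injective_0)
    then show ?thesis using h by (simp add: prod_eq_iff)
  qed
  then show ?thesis using linear_injective_0[OF linear_cone_deriv[OF c z]] by blast
qed

lemma sharp_cone_eqI:
  assumes c: "c \<in> A" and z: "z \<in> chart_cod c \<times> open_time"
    and "\<And>k. (cos (snd z))\<^sup>2 * induced_metric \<phi> c (fst z) (fst u) (fst k) + snd u * snd k = l k"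
  shows "sharp (induced_metric (cone_map \<phi>) (cone_chart c)) z l = u"
  by (rule sharp_eqI[OF linear_cone_deriv[OF c z] inj_cone_deriv[OF c z]])
     (auto simp: induced_metric_cone[OF c z] inner_cone_deriv[OF c z] assms(3))

text \<open>The normal is constant in \<open>t\<close>, so the radial direction lies in the kernel.
  Along \<open>M\<close> the defining equation has one factor \<open>cos t\<close> from the
  differential of the cone and two from the metric, which leaves \<open>1 / cos t\<close>.\<close>

lemma shape_op_cone:
  assumes c: "c \<in> A" and z: "z \<in> chart_cod c \<times> open_time"
  shows "shape_op (cone_map \<phi>) (cone_normal \<phi> \<nu>) (cone_chart c) z h =
    ((1 / cos (snd z)) *\<^sub>R shape_op \<phi> \<nu> c (fst z) (fst h), 0)"
proof -
  have y: "fst z \<in> chart_cod c" and cos: "cos (snd z) \<noteq> 0" using z cos_pos[of "snd z"] by auto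
  show ?thesis
    unfolding shape_op_def[of "cone_map \<phi>"]
    by (rule sharp_cone_eqI[OF c z])
       (use cos in \<open>simp add: chart_deriv_cone_map[OF c z] chart_deriv_cone_normal[OF c z]
         cone_deriv_def induced_metric_def[of \<phi>] linear_cmul[OF linear_deriv(1)[OF c y]]
         inner_shape_op[OF c y] inner_diff_right deriv_tangent(2)[OF c y] power2_eq_square\<close>)
qed

text \<open>The radial direction adds nothing to the trace, but it raises by one the dimension that
  the trace is divided by.\<close>

lemma mean_curvature_cone:
  assumes c: "c \<in> A" and z: "z \<in> chart_cod c \<times> open_time"
  shows "mean_curvature (cone_map \<phi>) (cone_normal \<phi> \<nu>) (cone_chart c) z =
    DIM('e) / (DIM('e) + 1) / cos (snd z) * mean_curvature \<phi> \<nu> c (fst z)"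
  by (simp add: mean_curvature_def trace_op_prod shape_op_cone[OF c z] trace_op_scaleR)

lemma shape_norm2_cone:
  assumes c: "c \<in> A" and z: "z \<in> chart_cod c \<times> open_time"
  shows "shape_norm2 (cone_map \<phi>) (cone_normal \<phi> \<nu>) (cone_chart c) z =
    shape_norm2 \<phi> \<nu> c (fst z) / (cos (snd z))\<^sup>2"
proof -
  have y: "fst z \<in> chart_cod c" and cos: "cos (snd z) \<noteq> 0" using z cos_pos[of "snd z"] by auto
  have "sharp (induced_metric (cone_map \<phi>) (cone_chart c)) z
      (\<lambda>w. induced_metric (cone_map \<phi>) (cone_chart c) z
        (shape_op (cone_map \<phi>) (cone_normal \<phi> \<nu>) (cone_chart c) z h)
        (shape_op (cone_map \<phi>) (cone_normal \<phi> \<nu>) (cone_chart c) z w)) =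
      ((1 / (cos (snd z))\<^sup>2) *\<^sub>R shape_square c (fst z) (fst h), 0)" for h
    by (rule sharp_cone_eqI[OF c z])
       (use cos in \<open>simp add: induced_metric_cone[OF c z] shape_op_cone[OF c z] induced_metric_def[of \<phi>]
         linear_cmul[OF linear_deriv(1)[OF c y]] inner_shape_square[OF c y] power2_eq_square\<close>)
  then show ?thesis
    by (simp add: shape_norm2_def[of "cone_map \<phi>"] trace_op_prod trace_op_scaleR shape_norm2_eq)
qed

lemma vol_density_cone:
  assumes c: "c \<in> A" and z: "z \<in> chart_cod c \<times> open_time"
  shows "vol_density (induced_metric (cone_map \<phi>) (cone_chart c)) z =
    cos (snd z) ^ DIM('e) * vol_density (induced_metric \<phi> c) (fst z)"
proof -
  have y: "fst z \<in> chart_cod c" and cos: "cos (snd z) > 0" using z cos_pos[of "snd z"] by auto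
  have "vol_density (induced_metric (cone_map \<phi>) (cone_chart c)) z =
      sqrt (((cos (snd z))\<^sup>2) ^ DIM('e)) * vol_density (induced_metric \<phi> c) (fst z)"
    by (rule vol_density_warped)
       (simp_all add: induced_metric_cone[OF c z] induced_metric_def[of \<phi>] linear_0[OF linear_deriv(1)[OF c y]])
  then show ?thesis using cos by (simp add: real_sqrt_power)
qed

lemma cone_oriented_hypersurface:
  "oriented_hypersurface (cone_atlas A) (cone_map \<phi>) (cone_normal \<phi> \<nu>)"
  unfolding oriented_hypersurface_def
proof (intro conjI)
  have sub: "chart_dom (cone_chart c) \<inter> manifold (cone_atlas A) = chart_dom (cone_chart c)" if "c \<in> A" for c
    using that by (auto simp: manifold_def cone_atlas_def)
  show "DIM('v \<times> real) = DIM('e \<times> real) + 2" using DIM by simp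
  show "smooth_atlas (cone_atlas A)" by (rule smooth_atlas_cone_atlas[OF atlas])
  show "smooth_map (cone_atlas A) (manifold (cone_atlas A)) (cone_map \<phi>)"
    "smooth_map (cone_atlas A) (manifold (cone_atlas A)) (cone_normal \<phi> \<nu>)"
    unfolding smooth_map_def smooth_on_def
    using Ck_on_cone_map Ck_on_cone_normal sub by (auto simp: cone_atlas_def o_def)
  have "norm (cone_map \<phi> q) = 1 \<and> norm (cone_normal \<phi> \<nu> q) = 1 \<and> cone_normal \<phi> \<nu> q \<bullet> cone_map \<phi> q = 0"
    if q: "q \<in> manifold (cone_atlas A)" for q
  proof -
    obtain p t where "q = (p, t)" and p: "p \<in> manifold A"
      using q by (auto simp: manifold_def cone_atlas_def cone_chart_dom)
    then show ?thesis
      by (simp add: cone_normal_eq cone_map_def norm_eq_1 unit[OF p] normal[OF p] power2_eq_square[symmetric])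
  qed
  then show "\<forall>q\<in>manifold (cone_atlas A). norm (cone_map \<phi> q) = 1 \<and> norm (cone_normal \<phi> \<nu> q) = 1 \<and>
      cone_normal \<phi> \<nu> q \<bullet> cone_map \<phi> q = 0" by blast
  have "inj (chart_deriv (cone_map \<phi>) (cone_chart c) z) \<and>
      (\<forall>h. cone_normal \<phi> \<nu> (param (cone_chart c) z) \<bullet> chart_deriv (cone_map \<phi>) (cone_chart c) z h = 0)"
    if c: "c \<in> A" and "z \<in> chart_cod (cone_chart c)" for c z
  proof -
    have z: "z \<in> chart_cod c \<times> open_time" using that(2) by (simp only: cone_chart_cod)
    then have y: "fst z \<in> chart_cod c" by auto
    show ?thesis
      using inj_cone_deriv[OF c z] deriv_normal[OF c y] normal[OF param_in_manifold[OF c y]]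
      by (simp add: chart_deriv_cone_map[OF c z] cone_normal_param[OF c z] cone_deriv_def inner_diff_right)
  qed
  then show "\<forall>c\<in>cone_atlas A. \<forall>y\<in>chart_cod c. inj (chart_deriv (cone_map \<phi>) c y) \<and>
      (\<forall>v. cone_normal \<phi> \<nu> (param c y) \<bullet> chart_deriv (cone_map \<phi>) c y v = 0)"
    by (auto simp: cone_atlas_def simp del: image_iff)
qed

lemma cone_minimal:
  assumes min: "\<And>p. p \<in> manifold A \<Longrightarrow> minimal_at A \<phi> \<nu> p"
  shows "cone_minimal_hypersurface A \<phi> \<nu>"
  unfolding cone_minimal_hypersurface_def
proof (intro conjI ballI cone_oriented_hypersurface)
  fix q assume q: "q \<in> cone A"
  show "minimal_at (cone_atlas A) (cone_map \<phi>) (cone_normal \<phi> \<nu>) q"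
    unfolding minimal_at_def
  proof (intro ballI impI)
    fix d assume "d \<in> cone_atlas A" and qd: "q \<in> chart_dom d"
    then obtain c where c: "c \<in> A" and d: "d = cone_chart c" by (auto simp: cone_atlas_def)
    obtain p t where pt: "q = (p, t)" "p \<in> chart_dom c" "t \<in> open_time"
      using qd by (auto simp: d cone_chart_dom)
    then have z: "snd d q \<in> chart_cod c \<times> open_time" by (simp add: d cone_chart_apply)
    have "mean_curvature \<phi> \<nu> c (snd c p) = 0"
      using min[of p] c pt(2) by (auto simp: minimal_at_def manifold_def)
    then show "mean_curvature (cone_map \<phi>) (cone_normal \<phi> \<nu>) d (snd d q) = 0"
      using mean_curvature_cone[OF c z[unfolded d]] by (simp add: d pt(1) cone_chart_apply)
  qed
qed

lemma sphere_ricci_cone: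
  assumes p: "p \<in> manifold A" and t: "t \<in> open_time"
  shows "sphere_ricci (cone_map \<phi> (p, t)) (cone_normal \<phi> \<nu> (p, t)) (cone_normal \<phi> \<nu> (p, t)) = DIM('e) + 1"
proof -
  \<comment> \<open>\<open>sin t = 1\<close> is the pole omitted by the stereographic
    parametrization.\<close>
  have "(sin t)\<^sup>2 < 1" using cos_pos[OF t] by (simp add: sin_squared_eq)
  then have "sin t < 1" by (simp add: power2_less_1_iff abs_less_iff)
  then have "sphere_ricci (cos t *\<^sub>R \<phi> p, sin t) (\<nu> p, 0) (\<nu> p, 0) = real DIM('v) - 1"
    by (intro sphere_ricci_horizontal)
       (simp_all add: unit[OF p] normal[OF p] power2_eq_square[symmetric])
  then show ?thesis using DIM by (simp add: cone_normal_eq[OF p] cone_map_def)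
qed

text \<open>The second argument is radial because the gradient of a function of \<open>t\<close> is.
  In the Koszul formula every metric coefficient with a radial slot is constant, so only the
  \<open>t\<close>-derivative of \<open>cos^2 t\<close> survives.\<close>

lemma christoffel_cone:
  assumes c: "c \<in> A" and z: "z \<in> chart_cod c \<times> open_time"
  shows "christoffel (induced_metric (cone_map \<phi>) (cone_chart c)) z h (0, r) =
    (- (r * tan (snd z)) *\<^sub>R fst h, 0)"
proof -
  let ?g = "induced_metric (cone_map \<phi>) (cone_chart c)"
  have y: "fst z \<in> chart_cod c" and cos: "cos (snd z) \<noteq> 0" using z cos_pos[of "snd z"] by auto
  have lin: "chart_deriv \<phi> c x 0 = 0" if "x \<in> chart_cod c" for x
    by (rule linear_0[OF linear_deriv(1)[OF c that]])
  have const: "frechet_derivative (\<lambda>x. ?g x h k) (at z) = (\<lambda>_. 0)" if "fst h = 0 \<or> fst k = 0" for h k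
  proof -
    have "frechet_derivative (\<lambda>x. ?g x h k) (at z) = frechet_derivative (\<lambda>_. snd h * snd k) (at z)"
      using that
      by (intro frechet_derivative_eq_on_open[OF open_cone_cod[OF c] z])
         (auto simp: induced_metric_cone[OF c] induced_metric_def[of \<phi>] lin)
    then show ?thesis by simp
  qed
  have time: "frechet_derivative (\<lambda>x. ?g x h k) (at z) (0, r) =
      - (2 * r * cos (snd z) * sin (snd z) * induced_metric \<phi> c (fst z) (fst h) (fst k))" for k
  proof -
    have "((\<lambda>y. chart_deriv \<phi> c y v) has_derivative
        frechet_derivative (\<lambda>y. chart_deriv \<phi> c y v) (at (fst z))) (at (fst z))" for v
      using Ck_on_SucD(1)[OF Ck_on_chart_deriv[OF atlas smooth_\<phi> c] open_chart_cod[OF atlas c] y] .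
    \<comment> \<open>\<open>D\<close> can stay anonymous: in the end it is evaluated only at
      \<open>fst (0, r) = 0\<close>.\<close>
    then obtain D where D: "((\<lambda>y. induced_metric \<phi> c y (fst h) (fst k)) has_derivative D) (at (fst z))"
      unfolding induced_metric_def using has_derivative_inner by blast
    have "((\<lambda>x. (cos (snd x))\<^sup>2 * induced_metric \<phi> c (fst x) (fst h) (fst k) + snd h * snd k) has_derivative
        (\<lambda>u. (cos (snd z))\<^sup>2 * D (fst u)
          - 2 * snd u * cos (snd z) * sin (snd z) * induced_metric \<phi> c (fst z) (fst h) (fst k))) (at z)"
      by (rule has_derivative_compose[OF has_derivative_fst[OF has_derivative_ident] D]
          derivative_eq_intros refl)+ (simp add: fun_eq_iff algebra_simps)
    then have "((\<lambda>x. ?g x h k) has_derivative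
        (\<lambda>u. (cos (snd z))\<^sup>2 * D (fst u)
          - 2 * snd u * cos (snd z) * sin (snd z) * induced_metric \<phi> c (fst z) (fst h) (fst k))) (at z)"
      by (rule has_derivative_transform_within_open[OF _ open_cone_cod[OF c] z])
         (simp add: induced_metric_cone[OF c])
    then show ?thesis
      using linear_0[OF has_derivative_linear[OF D]] by (simp add: frechet_derivative_at[symmetric])
  qed
  show ?thesis
    unfolding christoffel_def
    by (rule sharp_cone_eqI[OF c z])
       (use cos in \<open>simp add: const time induced_metric_def[of \<phi>] linear_cmul[OF linear_deriv(1)[OF c y]]
         linear_neg[OF linear_deriv(1)[OF c y]] tan_def power2_eq_square\<close>)
qed

text \<open>The Hessian has the entry \<open>\<gamma>''\<close> in the radial direction and, by
  \<open>christoffel_cone\<close>, \<open>- tan t * \<gamma>'\<close> in each of the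
  \<open>DIM('e)\<close> directions of \<open>M\<close>.\<close>

lemma laplacian_cone:
  assumes c: "c \<in> A" and z: "z \<in> chart_cod c \<times> open_time"
    and f: "\<And>x. x \<in> chart_cod c \<times> open_time \<Longrightarrow> f x = \<gamma> (snd x)"
    and \<gamma>: "\<And>t. t \<in> open_time \<Longrightarrow> (\<gamma> has_real_derivative \<gamma>' t) (at t)"
      "\<And>t. t \<in> open_time \<Longrightarrow> (\<gamma>' has_real_derivative \<gamma>'' t) (at t)"
  shows "laplacian (induced_metric (cone_map \<phi>) (cone_chart c)) f z =
    \<gamma>'' (snd z) - DIM('e) * tan (snd z) * \<gamma>' (snd z)"
proof -
  let ?g = "induced_metric (cone_map \<phi>) (cone_chart c)"
  have time: "((\<lambda>x. \<beta> (snd x)) has_derivative (\<lambda>h. \<beta>' * snd h)) (at x)"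
    if "(\<beta> has_real_derivative \<beta>') (at (snd x))" for \<beta> \<beta>' and x :: "'e \<times> real"
    using has_derivative_compose[OF has_derivative_snd[OF has_derivative_ident] that[unfolded has_field_derivative_def]]
    by simp
  have grad: "gradient ?g f x = (0, \<gamma>' (snd x))" if x: "x \<in> chart_cod c \<times> open_time" for x
  proof -
    have y: "fst x \<in> chart_cod c" and t: "snd x \<in> open_time" using x by auto
    have "frechet_derivative f (at x) = frechet_derivative (\<lambda>x. \<gamma> (snd x)) (at x)"
      by (rule frechet_derivative_eq_on_open[OF open_cone_cod[OF c] x f])
    also have "\<dots> = (\<lambda>h. \<gamma>' (snd x) * snd h)"
      using frechet_derivative_at[OF time[OF \<gamma>(1)[OF t]]] by simp
    finally show ?thesis
      unfolding gradient_def
      by (intro sharp_cone_eqI[OF c x])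
         (simp add: induced_metric_def[of \<phi>] linear_0[OF linear_deriv(1)[OF c y]])
  qed
  have t: "snd z \<in> open_time" using z by auto
  have "((\<lambda>x. (0::'e, \<gamma>' (snd x))) has_derivative (\<lambda>h. (0, \<gamma>'' (snd z) * snd h))) (at z)"
    by (intro has_derivative_Pair has_derivative_const time \<gamma> t)
  then have "(gradient ?g f has_derivative (\<lambda>h. (0, \<gamma>'' (snd z) * snd h))) (at z)"
    by (rule has_derivative_transform_within_open[OF _ open_cone_cod[OF c] z]) (simp add: grad)
  then have "cov_deriv ?g (gradient ?g f) z h =
      (- (\<gamma>' (snd z) * tan (snd z)) *\<^sub>R fst h, \<gamma>'' (snd z) * snd h)" for h
    by (simp add: cov_deriv_def grad[OF z] christoffel_cone[OF c z] frechet_derivative_at[symmetric])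
  then show ?thesis
    unfolding laplacian_def trace_op_prod
    by (simp only: fst_conv snd_conv trace_op_scaleR trace_op_ident) simp
qed

end


section \<open>Cell decompositions and the test function\<close>

text \<open>Guarantees that the \<open>SOME\<close> in \<open>truncated_cone_cells\<close> denotes a
  genuine decomposition. Finitely many chart neighbourhoods cover \<open>M\<close> and are made
  disjoint one after the other.\<close>

lemma exists_cell_decomposition:
  assumes "closed_manifold A"
  shows "\<exists>cells. cell_decomposition A cells"
proof -
  have A: "smooth_atlas A" and M: "compact (manifold A)"
    using assms by (auto simp: closed_manifold_def)
  have "\<exists>c W. c \<in> A \<and> open W \<and> p \<in> W \<and> compact (closure W) \<and> closure W \<subseteq> chart_dom c"
    if p: "p \<in> manifold A" for p
  proof -
    obtain c where c: "c \<in> A" "p \<in> chart_dom c" using p by (auto simp: manifold_def)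
    obtain r where r: "r > 0" "cball (snd c p) r \<subseteq> chart_cod c"
      using open_chart_cod[OF A c(1)] c(2) open_contains_cball by (metis image_eqI)
    define W where "W = chart_dom c \<inter> snd c -` ball (snd c p) r"
    \<comment> \<open>Compact in a Hausdorff space, hence closed: it traps the closure of
      \<open>W\<close>, which is taken in the whole ambient type and might otherwise leave the chart
      domain.\<close>
    define K where "K = param c ` cball (snd c p) r"
    have "open W"
      unfolding W_def
      by (rule continuous_open_preimage[OF continuous_chart[OF A c(1)] open_chart_dom[OF A c(1)] open_ball])
    moreover have "compact K"
      unfolding K_def
      by (rule compact_continuous_image[OF continuous_on_subset[OF continuous_param[OF A c(1)] r(2)] compact_cball])
    moreover have "W \<subseteq> K"
    proof
      fix q assume "q \<in> W"
      then have "q \<in> chart_dom c" "snd c q \<in> cball (snd c p) r" by (auto simp: W_def)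
      then show "q \<in> K" using param_chart[OF A c(1)] by (metis K_def image_eqI)
    qed
    then have "closure W \<subseteq> K"
      using \<open>compact K\<close> by (simp add: closure_minimal compact_imp_closed)
    moreover have "K \<subseteq> chart_dom c"
      unfolding K_def using r(2) param_in_dom[OF A c(1)] by blast
    moreover have "p \<in> W" using c(2) r(1) by (simp add: W_def)
    moreover have "compact (closure W)"
      using \<open>compact K\<close> \<open>closure W \<subseteq> K\<close> by (metis closed_closure compact_Int_closed inf.absorb_iff2)
    ultimately show ?thesis using c(1) by blast
  qed
  then obtain c W where W: "\<And>p. p \<in> manifold A \<Longrightarrow> c p \<in> A \<and> open (W p) \<and> p \<in> W p \<and>
      compact (closure (W p)) \<and> closure (W p) \<subseteq> chart_dom (c p)"
    by metis
  have disjointify: "\<exists>cells. finite cells \<and>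
     (\<forall>(c, B)\<in>cells. c \<in> A \<and> B \<in> sets borel \<and> compact (closure B) \<and> closure B \<subseteq> chart_dom c) \<and>
     pairwise (\<lambda>(c, B) (d, B'). B \<inter> B' = {}) cells \<and> (\<Union>(c, B)\<in>cells. B) = (\<Union>p\<in>D. W p)"
    if "finite D" "D \<subseteq> manifold A" for D
    using that
  proof (induction D)
    case empty
    then show ?case by (intro exI[of _ "{}"]) auto
  next
    case (insert p D)
    then obtain cells where cells: "finite cells"
      "\<forall>(c, B)\<in>cells. c \<in> A \<and> B \<in> sets borel \<and> compact (closure B) \<and> closure B \<subseteq> chart_dom c"
      "pairwise (\<lambda>(c, B) (d, B'). B \<inter> B' = {}) cells" "(\<Union>(c, B)\<in>cells. B) = (\<Union>p\<in>D. W p)"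
      by auto
    define B where "B = W p - (\<Union>p\<in>D. W p)"
    have p: "p \<in> manifold A" using insert.prems by simp
    have "open (\<Union>p\<in>D. W p)" using W insert.prems by blast
    then have "B \<in> sets borel" using W[OF p] by (auto simp: B_def)
    moreover have sub: "closure B \<subseteq> closure (W p)" by (auto simp: B_def intro!: closure_mono)
    then have "compact (closure B)"
      using W[OF p] by (metis closed_closure compact_Int_closed inf.absorb_iff2)
    moreover have "B \<inter> B' = {}" if "(d, B') \<in> cells" for d B'
      using cells(4) that by (force simp: B_def)
    then have "pairwise (\<lambda>(c, B) (d, B'). B \<inter> B' = {}) (insert (c p, B) cells)"
      using cells(3) by (auto simp: pairwise_insert)
    moreover have "(\<Union>(c, B)\<in>insert (c p, B) cells. B) = (\<Union>p\<in>insert p D. W p)"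
      unfolding UN_insert cells(4) by (simp add: B_def)
    moreover have "closure B \<subseteq> chart_dom (c p)" using sub W[OF p] by blast
    ultimately have "finite (insert (c p, B) cells) \<and>
     (\<forall>(c, B)\<in>insert (c p, B) cells. c \<in> A \<and> B \<in> sets borel \<and> compact (closure B) \<and> closure B \<subseteq> chart_dom c) \<and>
     pairwise (\<lambda>(c, B) (d, B'). B \<inter> B' = {}) (insert (c p, B) cells) \<and>
     (\<Union>(c, B)\<in>insert (c p, B) cells. B) = (\<Union>p\<in>insert p D. W p)"
      using cells(1,2) W[OF p] by (intro conjI) (simp_all only: finite_insert ball_insert prod.case simp_thms)
    then show ?case by (rule exI)
  qed
  obtain D where D: "D \<subseteq> manifold A" "finite D" "manifold A \<subseteq> (\<Union>p\<in>D. W p)"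
    using compactE_image[OF M, of "manifold A" W] W by blast
  have "W p \<subseteq> manifold A" if "p \<in> D" for p
    using W[of p] closure_subset[of "W p"] D(1) that unfolding manifold_def by blast
  then have eq: "(\<Union>p\<in>D. W p) = manifold A" using D(3) by blast
  show ?thesis
    unfolding cell_decomposition_def by (rule disjointify[OF D(2,1), unfolded eq])
qed

text \<open>The cells of the truncated cone form an image set; injectivity keeps two cells from
  being counted as one in the sum.\<close>

lemma inj_cone_chart: "cone_chart c = cone_chart d \<Longrightarrow> c = d"
proof -
  assume eq: "cone_chart c = cone_chart d"
  have "(0::real) \<in> open_time" by simp
  moreover have "chart_dom c \<times> open_time = chart_dom d \<times> open_time"
    using eq by (metis cone_chart_dom)
  ultimately have "chart_dom c = chart_dom d" by (rule Times_eq_cancel2[THEN iffD1])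
  moreover have "snd c p = snd d p" for p
    using eq cone_chart_apply by (metis fst_conv)
  ultimately show "c = d" by (simp add: prod_eq_iff ext)
qed

text \<open>Here \<open>sin t\<close> is the Jacobi field of the totally geodesic cone, so that only the summand
  \<open>c0 * tan t\<close> of the test function contributes.\<close>

lemma test_function_geodesic_part:
  fixes n :: nat and t c0 :: real
  assumes t: "0 < c0" "c0 \<le> cos t" and n: "2 \<le> n"
  shows "cos t ^ n * (- (sin t - c0 * tan t) * ((- sin t - 2 * c0 * tan t / (cos t)\<^sup>2)
      - n * tan t * (cos t - c0 / (cos t)\<^sup>2)) - (n + 1) * (sin t - c0 * tan t)\<^sup>2) \<le> c0 * (n + 1)"
proof -
  define x where "x = cos t"
  have x: "x > 0" "c0 \<le> x" "x \<le> 1" using t by (auto simp: x_def)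
  \<comment> \<open>One power of \<open>x = cos t\<close> is spent on the denominator of
    \<open>tan t\<close>.\<close>
  obtain m where m: "n = Suc m" using n by (cases n) auto
  define P where "P = (sin t)\<^sup>2 * (1 - c0 / x) * x ^ m"
  have r: "0 \<le> 1 - c0 / x" "1 - c0 / x \<le> 1" using x t by auto
  have P: "0 \<le> P" "P \<le> 1"
  proof -
    show "0 \<le> P" using r x by (simp add: P_def)
    have "(sin t)\<^sup>2 * (1 - c0 / x) \<le> 1 * 1"
      using r abs_sin_le_one[of t] by (intro mult_mono) (auto simp: abs_square_le_1)
    then have "P \<le> 1 * 1"
      unfolding P_def using x r by (intro mult_mono power_le_one) auto
    then show "P \<le> 1" by simp
  qed
  have "cos t ^ n * (- (sin t - c0 * tan t) * ((- sin t - 2 * c0 * tan t / (cos t)\<^sup>2)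
      - n * tan t * (cos t - c0 / (cos t)\<^sup>2)) - (n + 1) * (sin t - c0 * tan t)\<^sup>2)
    = c0 * (P * ((n + 1) - (n - 2) / x\<^sup>2))"
  proof -
    have "- (sin t - c0 * tan t) * ((- sin t - 2 * c0 * tan t / (cos t)\<^sup>2)
      - n * tan t * (cos t - c0 / (cos t)\<^sup>2)) - (n + 1) * (sin t - c0 * tan t)\<^sup>2
      = c0 * ((sin t)\<^sup>2 / x * (1 - c0 / x) * ((n + 1) - (real n - 2) / x\<^sup>2))"
      using x(1) unfolding tan_def x_def[symmetric]
      by (simp add: divide_simps) (simp add: power2_eq_square algebra_simps)
    \<comment> \<open>\<open>n - 2\<close> in the claim is a difference of naturals, equal to the
      real one because \<open>2 \<le> n\<close>.\<close>
    then show ?thesis using x(1) n by (simp add: m P_def x_def[symmetric] of_nat_diff)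
  qed
  \<comment> \<open>The discarded term is of order \<open>1 / x\<^sup>2\<close> and nonpositive, so
    the bound is uniform up to the vertex.\<close>
  also have "\<dots> \<le> c0 * (P * (n + 1))"
    using t P by (intro mult_left_mono) auto
  also have "\<dots> \<le> c0 * (1 * (n + 1))"
    using t P by (intro mult_left_mono mult_right_mono) auto
  finally show ?thesis by simp
qed

text \<open>On this interval \<open>cos t\<close> and \<open>- sin t\<close> are at least
  \<open>1/2\<close>, so \<open>c0 \<le> 1/4\<close> gives \<open>1 - c0 / cos t \<ge> 1/2\<close>
  and a test function of size at least \<open>1/4\<close>. Its square gives \<open>1/16\<close>, and
  division by \<open>(cos t)\<^sup>2 \<le> 1\<close> does not decrease it.\<close>

lemma test_function_lower_bound:
  fixes t c0 :: real
  assumes t: "- (pi/3) \<le> t" "t \<le> - (pi/6)" and c0: "0 \<le> c0" "c0 \<le> 1/4"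
  shows "(1/16) * (1/2) ^ n \<le> cos t ^ n * ((sin t - c0 * tan t)\<^sup>2 / (cos t)\<^sup>2)"
proof -
  have x: "1/2 \<le> cos t" "cos t \<le> 1"
    using cos_monotone_minus_pi_0'[of "-(pi/3)" t] t by (auto simp: cos_60)
  have s: "sin t \<le> - (1/2)"
    using sin_monotone_2pi_le[of t "-(pi/6)"] t pi_gt_zero by (auto simp: sin_30)
  have "c0 / cos t \<le> (1/4) / (1/2)"
    using x c0 by (intro frac_le) auto
  then have r: "1/2 \<le> 1 - c0 / cos t" by simp
  have "(1/2) * (1/2) \<le> - sin t * (1 - c0 / cos t)"
    using s r by (intro mult_mono) auto
  also have "\<dots> = - (sin t - c0 * tan t)" by (simp add: tan_def algebra_simps)
  finally have "(1/4)\<^sup>2 \<le> (- (sin t - c0 * tan t))\<^sup>2"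
    by (intro power_mono) auto
  then have g: "1/16 \<le> (sin t - c0 * tan t)\<^sup>2" by (simp only: power2_minus) (simp add: power2_eq_square)
  have "(sin t - c0 * tan t)\<^sup>2 * (cos t)\<^sup>2 \<le> (sin t - c0 * tan t)\<^sup>2 * 1"
    using x by (intro mult_left_mono power_le_one) auto
  then have "(sin t - c0 * tan t)\<^sup>2 \<le> (sin t - c0 * tan t)\<^sup>2 / (cos t)\<^sup>2"
    using x by (simp add: pos_le_divide_eq)
  then have "1/16 \<le> (sin t - c0 * tan t)\<^sup>2 / (cos t)\<^sup>2" using g by linarith
  moreover have "(1/2) ^ n \<le> cos t ^ n" using x by (intro power_mono) auto
  ultimately have "(1/2) ^ n * (1/16) \<le> cos t ^ n * ((sin t - c0 * tan t)\<^sup>2 / (cos t)\<^sup>2)"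
    using x by (intro mult_mono) auto
  then show ?thesis by simp
qed

lemma test_function_derivatives:
  assumes "t \<in> open_time"
  shows "((\<lambda>t. sin t - c0 * tan t) has_real_derivative cos t - c0 / (cos t)\<^sup>2) (at t)"
    and "((\<lambda>t. cos t - c0 / (cos t)\<^sup>2) has_real_derivative - sin t - 2 * c0 * tan t / (cos t)\<^sup>2) (at t)"
proof -
  have nz: "cos t \<noteq> 0" "(cos t)\<^sup>2 \<noteq> 0" using cos_gt_zero_pi[of t] assms by auto
  show "((\<lambda>t. sin t - c0 * tan t) has_real_derivative cos t - c0 / (cos t)\<^sup>2) (at t)"
    by (rule derivative_eq_intros refl nz)+ (simp add: divide_inverse)
  show "((\<lambda>t. cos t - c0 / (cos t)\<^sup>2) has_real_derivative - sin t - 2 * c0 * tan t / (cos t)\<^sup>2) (at t)"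
    by (rule derivative_eq_intros refl nz)+
       (use nz in \<open>simp add: tan_def power2_eq_square field_simps\<close>)
qed


section \<open>The index form\<close>

text \<open>The chart image of a Borel cell is its preimage under the continuous
  \<open>param\<close>, hence Borel; the closure of the cell supplies the compact set.\<close>

lemma cell_properties:
  assumes A: "smooth_atlas A" and cells: "cell_decomposition A cells" "(c, B) \<in> cells"
  shows "c \<in> A" and "B \<subseteq> chart_dom c" and "B \<in> sets borel"
    and "snd c ` B \<in> sets borel"
    and "\<exists>K. compact K \<and> snd c ` B \<subseteq> K \<and> K \<subseteq> chart_cod c"
proof -
  have c: "c \<in> A" and B: "B \<in> sets borel" "compact (closure B)" "closure B \<subseteq> chart_dom c"
    using cells unfolding cell_decomposition_def by blast+
  show "c \<in> A" "B \<in> sets borel" by fact+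
  show sub: "B \<subseteq> chart_dom c" using B(3) closure_subset by blast
  have "compact (snd c ` closure B)"
    by (rule compact_continuous_image[OF continuous_on_subset[OF continuous_chart[OF A c] B(3)] B(2)])
  then show "\<exists>K. compact K \<and> snd c ` B \<subseteq> K \<and> K \<subseteq> chart_cod c"
    using B(3) closure_subset by (intro exI[of _ "snd c ` closure B"]) blast
  have "chart_cod c \<in> sets borel" using open_chart_cod[OF A c] by simp
  moreover have "param c -` B \<inter> space (restrict_space borel (chart_cod c)) \<in>
      sets (restrict_space borel (chart_cod c))"
    using borel_measurable_continuous_on_restrict[OF continuous_param[OF A c]] B(1)
    by (rule measurable_sets)
  ultimately have "param c -` B \<inter> chart_cod c \<in> sets borel"
    by (simp add: sets_restrict_space_iff space_restrict_space)
  moreover have "param c -` B \<inter> chart_cod c = snd c ` B"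
    using sub param_chart[OF A c] chart_param[OF A c] by (auto simp: image_iff)
  ultimately show "snd c ` B \<in> sets borel" by simp
qed

lemma borel_Times_interval:
  "S \<in> sets (borel :: 'e::euclidean_space measure) \<Longrightarrow> S \<times> {a..b::real} \<in> sets (borel :: ('e \<times> real) measure)"
  by (metis atLeastAtMost_borel borel_prod pair_measureI)

text \<open>A continuous integrand may be unbounded on the chart \<open>U\<close>, so integrability
  comes from the compact \<open>K\<close> and is restricted to \<open>S\<close>.\<close>

lemma set_integrable_cylinder:
  fixes f :: "'e::euclidean_space \<times> real \<Rightarrow> real"
  assumes K: "compact K" "S \<subseteq> K" "K \<subseteq> U" and S: "S \<in> sets borel"
    and f: "continuous_on (U \<times> T) f" "{a..b} \<subseteq> T"
  shows "set_integrable lebesgue (S \<times> {a..b}) f"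
proof -
  have "continuous_on (K \<times> {a..b}) f"
    by (rule continuous_on_subset[OF f(1)]) (use K f in auto)
  then have "set_integrable lborel (K \<times> {a..b}) f"
    unfolding set_integrable_def using K(1) by (intro borel_integrable_compact compact_Times) auto
  then have "set_integrable lborel (S \<times> {a..b}) f"
    by (rule set_integrable_subset) (use K S borel_Times_interval in auto)
  then show ?thesis
    unfolding set_integrable_def
    by (metis (no_types, lifting) borel_measurable_integrable integrable_completion)
qed

section \<open>Where the second fundamental form vanishes\<close>

context oriented_immersion
begin

text \<open>The right-hand side involves only first derivatives of \<open>\<phi>\<close> and
  \<open>\<nu>\<close>, which a change of chart transforms by a single linear map.\<close>

lemma shape_norm2_eq_0_iff:
  assumes c: "c \<in> A" "y \<in> chart_cod c"
  shows "shape_norm2 \<phi> \<nu> c y = 0 \<longleftrightarrow> (\<forall>v w. chart_deriv \<nu> c y v \<bullet> chart_deriv \<phi> c y w = 0)"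
proof
  assume "shape_norm2 \<phi> \<nu> c y = 0"
  then have "shape_op \<phi> \<nu> c y v = 0" for v using shape_norm2_zero[OF c] by blast
  then show "\<forall>v w. chart_deriv \<nu> c y v \<bullet> chart_deriv \<phi> c y w = 0"
    using inner_shape_op[OF c] by (simp add: linear_0[OF linear_deriv(1)[OF c]])
next
  assume "\<forall>v w. chart_deriv \<nu> c y v \<bullet> chart_deriv \<phi> c y w = 0"
  then have "chart_deriv \<phi> c y (shape_square c y v) \<bullet> chart_deriv \<phi> c y w = chart_deriv \<phi> c y 0 \<bullet> chart_deriv \<phi> c y w"
    for v w
    unfolding inner_shape_square[OF c] inner_shape_op[OF c] by (simp add: linear_0[OF linear_deriv(1)[OF c]])
  then have "shape_square c y v = 0" for v
    by (rule inner_image_cancel[OF linear_deriv(1)[OF c] inj_deriv[OF c]])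
  then show "shape_norm2 \<phi> \<nu> c y = 0" by (simp add: shape_norm2_eq trace_op_def)
qed

lemma transition_differentiable:
  assumes "c \<in> A" "d \<in> A"
  shows "(snd d \<circ> param c) differentiable_on snd c ` (chart_dom c \<inter> chart_dom d)"
proof -
  have "smooth_on (snd c ` (chart_dom c \<inter> chart_dom d)) (snd d \<circ> param c)"
    using assms atlas unfolding smooth_atlas_def by blast
  then have "Ck_on (Suc 0) (snd c ` (chart_dom c \<inter> chart_dom d)) (snd d \<circ> param c)"
    unfolding smooth_on_def by blast
  then show ?thesis by simp
qed

lemma chart_deriv_transition:
  assumes c: "c \<in> A" and d: "d \<in> A" and p: "p \<in> chart_dom c" "p \<in> chart_dom d"
  obtains T where "\<And>v. chart_deriv \<phi> c (snd c p) v = chart_deriv \<phi> d (snd d p) (T v)"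
    "\<And>v. chart_deriv \<nu> c (snd c p) v = chart_deriv \<nu> d (snd d p) (T v)"
proof -
  let ?S = "snd c ` (chart_dom c \<inter> chart_dom d)"
  have S: "open ?S" by (rule open_chart_image[OF atlas c open_chart_dom[OF atlas d]])
  have y: "snd c p \<in> ?S" using p by blast
  obtain T where T: "((snd d \<circ> param c) has_derivative T) (at (snd c p))"
    using transition_differentiable[OF c d] y
    unfolding differentiable_on_eq_differentiable_at[OF S] differentiable_def by blast
  have at: "(snd d \<circ> param c) (snd c p) = snd d p" using param_chart[OF atlas c p(1)] by simp
  have "chart_deriv f c (snd c p) v = chart_deriv f d (snd d p) (T v)"
    if f: "smooth_map A (manifold A) f" for f :: "'m \<Rightarrow> 'v" and v
  proof -
    have "((\<lambda>y. f (param d ((snd d \<circ> param c) y))) has_derivative (\<lambda>v. chart_deriv f d (snd d p) (T v)))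
        (at (snd c p))"
      using has_derivative_compose[OF T] smooth_map_has_derivative[OF atlas f d, of "snd d p"] p(2)
      unfolding at by blast
    then have "((\<lambda>y. f (param c y)) has_derivative (\<lambda>v. chart_deriv f d (snd d p) (T v))) (at (snd c p))"
      by (rule has_derivative_transform_within_open[OF _ S y])
         (auto simp: param_chart[OF atlas c] param_chart[OF atlas d])
    then show ?thesis
      using smooth_map_has_derivative[OF atlas f c, of "snd c p"] p(1) has_derivative_unique by (metis imageI)
  qed
  then show ?thesis using that smooth_\<phi> smooth_\<nu> by blast
qed

text \<open>Enough for comparing zero sets between charts, which is all that locating a suitable
  cell requires.\<close>

lemma shape_norm2_chart_independent:
  assumes c: "c \<in> A" and d: "d \<in> A" and p: "p \<in> chart_dom c" "p \<in> chart_dom d"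
    and z: "shape_norm2 \<phi> \<nu> d (snd d p) = 0"
  shows "shape_norm2 \<phi> \<nu> c (snd c p) = 0"
proof -
  have y: "snd c p \<in> chart_cod c" "snd d p \<in> chart_cod d" using p by auto
  show ?thesis
    using z chart_deriv_transition[OF c d p]
    unfolding shape_norm2_eq_0_iff[OF c y(1)] shape_norm2_eq_0_iff[OF d y(2)] by metis
qed

text \<open>The cells are arbitrary Borel sets, so an open set of \<open>M\<close> need not contain interior points of
  any of them; but by finiteness it cannot meet all of them in null sets.\<close>

lemma exists_cell_not_negligible:
  assumes cells: "cell_decomposition A cells" and ng: "\<not> totally_geodesic A \<phi> \<nu>"
  obtains c B where "(c, B) \<in> cells" "\<not> negligible {y \<in> snd c ` B. shape_norm2 \<phi> \<nu> c y \<noteq> 0}"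
proof -
  let ?Z = "\<lambda>c B. {y \<in> snd c ` B. shape_norm2 \<phi> \<nu> c y \<noteq> 0}"
  obtain c y v where c: "c \<in> A" "y \<in> chart_cod c" "shape_op \<phi> \<nu> c y v \<noteq> 0"
    using ng unfolding totally_geodesic_def by blast
  let ?O = "{x \<in> chart_cod c. shape_norm2 \<phi> \<nu> c x \<noteq> 0}"
  have "?O = chart_cod c \<inter> shape_norm2 \<phi> \<nu> c -` (- {0})" by auto
  then have "open ?O"
    using continuous_open_preimage[OF continuous_shape_norm2[OF c(1)] open_chart_cod[OF atlas c(1)], of "- {0}"]
    by auto
  moreover have "y \<in> ?O" using c shape_norm2_zero by blast
  ultimately have "\<not> negligible ?O" using open_not_negligible by blast
  \<comment> \<open>If every cell contributed only a null set, the differentiable transition maps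
    into \<open>c\<close> would send these to null sets, and finitely many of them cover the open
    set \<open>?O\<close>.\<close>
  moreover have "negligible ?O" if neg: "\<And>d B. (d, B) \<in> cells \<Longrightarrow> negligible (?Z d B)"
  proof (rule negligible_subset)
    let ?T = "\<lambda>d. snd d ` (chart_dom d \<inter> chart_dom c)"
    let ?I = "\<lambda>(d, B). (snd c \<circ> param d) ` (?Z d B \<inter> ?T d)"
    have "negligible (?I (d, B))" if dB: "(d, B) \<in> cells" for d B
    proof -
      have "d \<in> A" using cell_properties(1)[OF atlas cells dB] .
      then have "(snd c \<circ> param d) differentiable_on (?Z d B \<inter> ?T d)"
        using transition_differentiable[OF _ c(1)] differentiable_on_subset by blast
      moreover have "negligible (?Z d B \<inter> ?T d)" using neg[OF dB] by (rule negligible_subset) blast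
      ultimately show ?thesis
        unfolding prod.case using negligible_differentiable_image_negligible[OF order_refl] by blast
    qed
    moreover have "finite cells" using cells unfolding cell_decomposition_def by blast
    ultimately show "negligible (\<Union>(?I ` cells))" by (intro negligible_Union) auto
    show "?O \<subseteq> \<Union>(?I ` cells)"
    proof
      fix x assume x: "x \<in> ?O"
      then have p: "param c x \<in> chart_dom c" using param_in_dom[OF atlas c(1)] by blast
      then have "param c x \<in> manifold A" using c(1) by (auto simp: manifold_def)
      then obtain d B where dB: "(d, B) \<in> cells" "param c x \<in> B"
        using cells unfolding cell_decomposition_def by blast
      have d: "d \<in> A" "param c x \<in> chart_dom d"
        using cell_properties(1,2)[OF atlas cells dB(1)] dB(2) by auto
      have cx: "snd c (param c x) = x" using x chart_param[OF atlas c(1)] by blast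
      have "shape_norm2 \<phi> \<nu> d (snd d (param c x)) \<noteq> 0"
        using shape_norm2_chart_independent[OF c(1) d(1) p d(2)] x cx by auto
      then have "snd d (param c x) \<in> ?Z d B \<inter> ?T d" using dB(2) p d(2) by blast
      moreover have "x = (snd c \<circ> param d) (snd d (param c x))"
        using param_chart[OF atlas d] cx by simp
      ultimately have "x \<in> ?I (d, B)" by blast
      then show "x \<in> \<Union>(?I ` cells)" using dB(1) by blast
    qed
  qed
  ultimately show ?thesis using that by blast
qed

text \<open>The Riemannian volume of the cell times \<open>pi / 2\<close>. The fixed interval
  contains \<open>{-\<epsilon>..0}\<close> for every admissible \<open>\<epsilon>\<close>, and
  stating it over the product domain allows comparison by monotonicity of the integral.\<close>

definition cell_volume :: "('m, 'e) chart \<times> 'm set \<Rightarrow> real" where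
  "cell_volume = (\<lambda>(c, B). set_lebesgue_integral lebesgue (snd c ` B \<times> {-(pi/2)..0})
     (\<lambda>z. vol_density (induced_metric \<phi> c) (fst z)))"

text \<open>The range of \<open>t\<close> avoids both the base and the vertex, which makes the lower bound on the test
  function uniform in \<open>\<epsilon>\<close>.\<close>

definition cell_energy :: "('m, 'e) chart \<times> 'm set \<Rightarrow> real" where
  "cell_energy = (\<lambda>(c, B). set_lebesgue_integral lebesgue (snd c ` B \<times> {-(pi/3)..-(pi/6)})
     (\<lambda>z. shape_norm2 \<phi> \<nu> c (fst z) * vol_density (induced_metric \<phi> c) (fst z)))"

lemma continuous_on_fst_chart:
  "c \<in> A \<Longrightarrow> continuous_on (chart_cod c) f \<Longrightarrow> continuous_on (chart_cod c \<times> T) (\<lambda>z. f (fst z))"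
  by (rule continuous_on_compose2[OF _ continuous_on_fst[OF continuous_on_id]]) auto

lemma cell_integrable:
  fixes f :: "'e \<times> real \<Rightarrow> real"
  assumes cells: "cell_decomposition A cells" "(c, B) \<in> cells"
    and f: "continuous_on (chart_cod c \<times> T) f" "{a..b} \<subseteq> T"
  shows "set_integrable lebesgue (snd c ` B \<times> {a..b}) f"
  using cell_properties(4,5)[OF atlas cells] set_integrable_cylinder[OF _ _ _ _ f] by blast

lemma cell_energy_nonneg:
  assumes cells: "cell_decomposition A cells" "(c, B) \<in> cells"
  shows "0 \<le> cell_energy (c, B)"
proof -
  have "0 \<le> shape_norm2 \<phi> \<nu> c y * vol_density (induced_metric \<phi> c) y" if "y \<in> snd c ` B" for y
  proof -
    have "c \<in> A" "y \<in> chart_cod c" using cell_properties(1,2)[OF atlas cells] that by auto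
    then show ?thesis
      by (intro mult_nonneg_nonneg shape_norm2_nonneg less_imp_le[OF induced_vol_density_pos])
  qed
  then show ?thesis
    unfolding cell_energy_def prod.case set_lebesgue_integral_def
    by (intro Bochner_Integration.integral_nonneg) (auto simp: indicator_def)
qed

text \<open>A zero integral of a nonnegative integrand would make \<open>?Z \<times> ?J\<close>
  null; as \<open>?J\<close> has positive length, \<open>?Z\<close> would be null too.\<close>

lemma cell_energy_pos:
  assumes cells: "cell_decomposition A cells" "(c, B) \<in> cells"
    and nn: "\<not> negligible {y \<in> snd c ` B. shape_norm2 \<phi> \<nu> c y \<noteq> 0}"
  shows "0 < cell_energy (c, B)"
proof (rule ccontr)
  let ?J = "{-(pi/3)..-(pi/6)}"
  let ?f = "\<lambda>z. shape_norm2 \<phi> \<nu> c (fst z) * vol_density (induced_metric \<phi> c) (fst z)"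
  let ?Z = "{y \<in> snd c ` B. shape_norm2 \<phi> \<nu> c y \<noteq> 0}"
  note cf = cell_properties[OF atlas cells]
  have cod: "snd c ` B \<subseteq> chart_cod c" using cf(2) by blast
  assume "\<not> 0 < cell_energy (c, B)"
  then have "integral\<^sup>L lebesgue (\<lambda>z. indicator (snd c ` B \<times> ?J) z *\<^sub>R ?f z) = 0"
    using cell_energy_nonneg[OF cells] by (simp add: cell_energy_def set_lebesgue_integral_def)
  moreover have "set_integrable lebesgue (snd c ` B \<times> ?J) ?f"
    by (rule cell_integrable[OF cells, where T=UNIV])
       (intro continuous_intros continuous_on_fst_chart continuous_shape_norm2 continuous_vol_density cf(1), simp)
  moreover have pos: "0 \<le> ?f z" "?f z = 0 \<longleftrightarrow> shape_norm2 \<phi> \<nu> c (fst z) = 0" if "fst z \<in> snd c ` B" for z :: "'e \<times> real"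
    using shape_norm2_nonneg[OF cf(1), of "fst z"] induced_vol_density_pos[OF cf(1), of "fst z"] that cod
    by auto
  ultimately have "AE z in lebesgue. indicator (snd c ` B \<times> ?J) z *\<^sub>R ?f z = 0"
    by (subst integral_nonneg_eq_0_iff_AE[symmetric])
       (auto simp: set_integrable_def indicator_def intro!: AE_I2)
  then have "AE z in lebesgue. z \<notin> ?Z \<times> ?J"
    by (rule AE_mp) (intro AE_I2 impI, use pos(2) in \<open>force simp: indicator_def\<close>)
  moreover have Zb: "?Z \<in> sets borel"
  proof -
    have "?Z = snd c ` B \<inter> (chart_cod c \<inter> shape_norm2 \<phi> \<nu> c -` (- {0}))" using cod by auto
    moreover have "open (chart_cod c \<inter> shape_norm2 \<phi> \<nu> c -` (- {0}))"
      using continuous_open_preimage[OF continuous_shape_norm2[OF cf(1)] open_chart_cod[OF atlas cf(1)], of "- {0}"]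
      by auto
    ultimately show ?thesis using cf(4) by auto
  qed
  ultimately have "?Z \<times> ?J \<in> null_sets lebesgue"
    using AE_iff_null_sets[of "?Z \<times> ?J" lebesgue] borel_Times_interval[OF Zb] by simp
  \<comment> \<open>The set is Borel, so nullity passes from the completion to
    \<open>lborel\<close>, where the product measure is available.\<close>
  then have "?Z \<times> ?J \<in> null_sets lborel"
    using null_sets_completion_iff[of "?Z \<times> ?J" lborel] borel_Times_interval[OF Zb] by simp
  then have "emeasure (lborel \<Otimes>\<^sub>M lborel) (?Z \<times> ?J) = 0"
    by (simp add: lborel_prod null_setsD1)
  then have "emeasure lborel ?Z * emeasure lborel ?J = 0"
    using lborel.emeasure_pair_measure_Times[of ?Z lborel ?J] Zb by simp
  then have "?Z \<in> null_sets lborel" using Zb using pi_gt_zero by (auto simp: null_sets_def)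
  then have "negligible ?Z"
    unfolding negligible_iff_null_sets by (rule null_sets_completionI)
  with nn show False ..
qed

section \<open>The index form evaluated at the test function\<close>

definition test_function :: "real \<Rightarrow> 'm \<times> real \<Rightarrow> real" where
  "test_function c0 = (\<lambda>(p, t). sin t - c0 * tan t)"

lemma smooth_test_function:
  "smooth_map_on (cone_atlas A) K (test_function c0)"
proof -
  have "smooth_map (cone_atlas A) UNIV (test_function c0)"
    unfolding smooth_map_def smooth_on_def
  proof (intro ballI allI)
    fix d k assume "d \<in> cone_atlas A"
    then obtain c where c: "c \<in> A" and d: "d = cone_chart c" by (auto simp: cone_atlas_def)
    have eq: "sin (snd z) + (- c0) * tan (snd z) = (test_function c0 \<circ> param d) z"
      if "z \<in> chart_cod c \<times> open_time" for z
      using that param_cone_chart[OF atlas c, of "fst z" "snd z"] by (auto simp: d test_function_def)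
    have "Ck_on k (chart_cod c \<times> open_time) (\<lambda>z. sin (snd z) + (- c0) * tan (snd z))"
      by (intro Ck_on_add open_cone_cod[OF c] Ck_on_snd[OF c open_UNIV] Ck_on_sin_cos[THEN conjunct1]
          Ck_on_linear_compose[OF open_cone_cod[OF c] bounded_linear_mult_right]
          Ck_on_snd[OF c open_greaterThanLessThan _ Ck_on_tan]) auto
    then show "Ck_on k (snd d ` (chart_dom d \<inter> UNIV)) (test_function c0 \<circ> param d)"
      using Ck_on_cong[OF open_cone_cod[OF c] eq] cone_chart_cod[of c] by (simp only: Int_UNIV_right d)
  qed
  then show ?thesis
    unfolding smooth_map_on_def by (intro ballI exI[of _ UNIV] exI[of _ "test_function c0"]) auto
qed

definition index_integrand :: "real \<Rightarrow> ('m \<times> real, 'e \<times> real) chart \<Rightarrow> 'e \<times> real \<Rightarrow> real" where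
  "index_integrand c0 d z = (let p = param d z; G = test_function c0 in
     - G p * laplacian (induced_metric (cone_map \<phi>) d) (G \<circ> param d) z
     - (sphere_ricci (cone_map \<phi> p) (cone_normal \<phi> \<nu> p) (cone_normal \<phi> \<nu> p)
        + shape_norm2 (cone_map \<phi>) (cone_normal \<phi> \<nu>) d z) * (G p)\<^sup>2)"

text \<open>The bracket separates the geodesic part, bounded above by
  \<open>test_function_geodesic_part\<close>, from the nonnegative factor of
  \<open>shape_norm2\<close> that \<open>test_function_lower_bound\<close> bounds below.\<close>

lemma index_integrand_eq:
  assumes c: "c \<in> A" and z: "z \<in> chart_cod c \<times> open_time"
  shows "index_integrand c0 (cone_chart c) z * vol_density (induced_metric (cone_map \<phi>) (cone_chart c)) z =
    (cos (snd z) ^ DIM('e) * (- (sin (snd z) - c0 * tan (snd z)) *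
        ((- sin (snd z) - 2 * c0 * tan (snd z) / (cos (snd z))\<^sup>2)
          - DIM('e) * tan (snd z) * (cos (snd z) - c0 / (cos (snd z))\<^sup>2))
        - (DIM('e) + 1) * (sin (snd z) - c0 * tan (snd z))\<^sup>2)
     - shape_norm2 \<phi> \<nu> c (fst z) *
        (cos (snd z) ^ DIM('e) * ((sin (snd z) - c0 * tan (snd z))\<^sup>2 / (cos (snd z))\<^sup>2)))
     * vol_density (induced_metric \<phi> c) (fst z)"
proof -
  have par: "param (cone_chart c) x = (param c (fst x), snd x)" if "x \<in> chart_cod c \<times> open_time" for x
    using that param_cone_chart[OF atlas c, of "fst x" "snd x"] by auto
  have lap: "laplacian (induced_metric (cone_map \<phi>) (cone_chart c)) (test_function c0 \<circ> param (cone_chart c)) z =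
      (- sin (snd z) - 2 * c0 * tan (snd z) / (cos (snd z))\<^sup>2)
          - DIM('e) * tan (snd z) * (cos (snd z) - c0 / (cos (snd z))\<^sup>2)"
    by (rule laplacian_cone[OF c z _ test_function_derivatives]) (simp_all add: par test_function_def)
  have "param c (fst z) \<in> manifold A" "snd z \<in> open_time"
    using z param_in_manifold[OF c] by auto
  note ricci = sphere_ricci_cone[OF this]
  show ?thesis
    unfolding index_integrand_def Let_def lap par[OF z] ricci shape_norm2_cone[OF c z] vol_density_cone[OF c z]
    by (simp add: test_function_def algebra_simps)
qed

lemma cell_index_bound:
  assumes cells: "cell_decomposition A cells" "(c, B) \<in> cells" and dim: "2 \<le> DIM('e)"
    and \<epsilon>: "pi / 3 \<le> \<epsilon>" "\<epsilon> < pi / 2" "cos \<epsilon> \<le> 1/4"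
  shows "set_lebesgue_integral lebesgue (snd (cone_chart c) ` (B \<times> {-\<epsilon>..0}))
      (\<lambda>z. index_integrand (cos \<epsilon>) (cone_chart c) z
        * vol_density (induced_metric (cone_map \<phi>) (cone_chart c)) z)
    \<le> cos \<epsilon> * (DIM('e) + 1) * cell_volume (c, B) - (1/16) * (1/2) ^ DIM('e) * cell_energy (c, B)"
proof -
  let ?S = "snd c ` B" and ?n = "DIM('e)" and ?c0 = "cos \<epsilon>"
  let ?\<rho> = "\<lambda>z::'e \<times> real. vol_density (induced_metric \<phi> c) (fst z)"
  let ?\<beta> = "\<lambda>z::'e \<times> real. shape_norm2 \<phi> \<nu> c (fst z)"
  let ?\<kappa> = "(1/16) * (1/2) ^ ?n :: real"
  define a where "a t = cos t ^ ?n * (- (sin t - ?c0 * tan t) *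
        ((- sin t - 2 * ?c0 * tan t / (cos t)\<^sup>2) - ?n * tan t * (cos t - ?c0 / (cos t)\<^sup>2))
        - (?n + 1) * (sin t - ?c0 * tan t)\<^sup>2)" for t
  define b where "b t = cos t ^ ?n * ((sin t - ?c0 * tan t)\<^sup>2 / (cos t)\<^sup>2)" for t
  let ?H = "\<lambda>z::'e \<times> real. (a (snd z) - ?\<beta> z * b (snd z)) * ?\<rho> z"
  note cf = cell_properties[OF atlas cells]
  have cod: "?S \<subseteq> chart_cod c" using cf(2) by blast
  have c0: "0 < ?c0" using \<epsilon> pi_gt_zero by (intro cos_gt_zero_pi) linarith+
  have tsub: "{-\<epsilon>..0} \<subseteq> open_time" using \<epsilon> by auto
  have img: "snd (cone_chart c) ` (B \<times> {-\<epsilon>..0}) = ?S \<times> {-\<epsilon>..0}"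
    by (force simp: cone_chart_def)
  have eq: "set_lebesgue_integral lebesgue (snd (cone_chart c) ` (B \<times> {-\<epsilon>..0}))
      (\<lambda>z. index_integrand ?c0 (cone_chart c) z * vol_density (induced_metric (cone_map \<phi>) (cone_chart c)) z)
    = set_lebesgue_integral lebesgue (?S \<times> {-\<epsilon>..0}) ?H"
    unfolding img set_lebesgue_integral_def
  proof (rule Bochner_Integration.integral_cong[OF refl])
    fix z :: "'e \<times> real"
    show "indicator (?S \<times> {-\<epsilon>..0}) z *\<^sub>R (index_integrand ?c0 (cone_chart c) z
        * vol_density (induced_metric (cone_map \<phi>) (cone_chart c)) z) = indicator (?S \<times> {-\<epsilon>..0}) z *\<^sub>R ?H z"
    proof (cases "z \<in> ?S \<times> {-\<epsilon>..0}")
      case True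
      then have "z \<in> chart_cod c \<times> open_time" using cod tsub by auto
      then show ?thesis using index_integrand_eq[OF cf(1)] by (simp only: a_def b_def)
    qed simp
  qed
  have nz: "cos t \<noteq> 0" if "t \<in> open_time" for t using cos_pos[OF that] by simp
  have cab: "continuous_on open_time a" "continuous_on open_time b"
    unfolding a_def[abs_def] b_def[abs_def] by (intro continuous_intros; use nz in force)+
  have csnd: "continuous_on (chart_cod c \<times> open_time) (\<lambda>z. f (snd z))"
    if "continuous_on open_time f" for f :: "real \<Rightarrow> real"
    by (rule continuous_on_compose2[OF that continuous_on_snd[OF continuous_on_id]]) auto
  have iH: "set_integrable lebesgue (?S \<times> {-\<epsilon>..0}) ?H"
    by (rule cell_integrable[OF cells _ tsub])
       (intro continuous_intros csnd cab continuous_on_fst_chart continuous_shape_norm2 continuous_vol_density cf(1))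
  have i\<rho>: "set_integrable lebesgue (?S \<times> {-(pi/2)..0}) ?\<rho>"
    by (rule cell_integrable[OF cells, where T=UNIV])
       (intro continuous_on_fst_chart continuous_vol_density cf(1), simp)
  have i\<beta>: "set_integrable lebesgue (?S \<times> {-(pi/3)..-(pi/6)}) (\<lambda>z. ?\<beta> z * ?\<rho> z)"
    by (rule cell_integrable[OF cells, where T=UNIV])
       (intro continuous_intros continuous_on_fst_chart continuous_shape_norm2 continuous_vol_density cf(1), simp)
  \<comment> \<open>With indicators the comparison holds on the whole space, so the volume may be
    taken over a larger interval than \<open>{-\<epsilon>..0}\<close> and the energy over a smaller
    one.\<close>
  have "indicator (?S \<times> {-\<epsilon>..0}) z *\<^sub>R ?H z \<le>
      ?c0 * (?n + 1) * (indicator (?S \<times> {-(pi/2)..0}) z *\<^sub>R ?\<rho> z)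
      - ?\<kappa> * (indicator (?S \<times> {-(pi/3)..-(pi/6)}) z *\<^sub>R (?\<beta> z * ?\<rho> z))" for z :: "'e \<times> real"
  proof (cases "fst z \<in> ?S")
    case True
    then have y: "fst z \<in> chart_cod c" using cod by blast
    have \<rho>: "0 < ?\<rho> z" and \<beta>: "0 \<le> ?\<beta> z"
      using induced_vol_density_pos[OF cf(1) y] shape_norm2_nonneg[OF cf(1) y] by auto
    show ?thesis
    proof (cases "snd z \<in> {-\<epsilon>..0}")
      case t: True
      then have "snd z \<in> open_time" and t2: "snd z \<in> {-(pi/2)..0}" using tsub \<epsilon> by auto
      have "?c0 \<le> cos (snd z)"
        using cos_monotone_minus_pi_0'[of "-\<epsilon>" "snd z"] t \<epsilon> by auto
      then have a: "a (snd z) \<le> ?c0 * (?n + 1)"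
        unfolding a_def using test_function_geodesic_part[OF c0 _ dim] by simp
      have b: "?\<kappa> * indicator {-(pi/3)..-(pi/6)} (snd z) \<le> b (snd z)"
      proof (cases "snd z \<in> {-(pi/3)..-(pi/6)}")
        case True
        then show ?thesis
          using test_function_lower_bound[of "snd z" ?c0 ?n] c0 \<epsilon> by (simp add: b_def)
      next
        case False
        then show ?thesis using cos_pos[OF \<open>snd z \<in> open_time\<close>] by (simp add: b_def)
      qed
      have "a (snd z) - ?\<beta> z * b (snd z) \<le>
          ?c0 * (?n + 1) - ?\<beta> z * (?\<kappa> * indicator {-(pi/3)..-(pi/6)} (snd z))"
        using a mult_left_mono[OF b \<beta>] by linarith
      then have "?H z \<le> (?c0 * (?n + 1) - ?\<beta> z * (?\<kappa> * indicator {-(pi/3)..-(pi/6)} (snd z))) * ?\<rho> z"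
        using \<rho> by (intro mult_right_mono) auto
      then show ?thesis
        using True t t2 by (auto simp: indicator_def mem_Times_iff algebra_simps)
    next
      case t: False
      \<comment> \<open>\<open>pi / 3 \<le> \<epsilon>\<close> places the energy interval inside the
        truncated cone; outside the cone only the nonnegative volume term is left.\<close>
      then have "snd z \<notin> {-(pi/3)..-(pi/6)}" using \<epsilon> pi_gt_zero by auto
      then show ?thesis using True t \<rho> c0 by (auto simp: indicator_def mem_Times_iff)
    qed
  qed (auto simp: indicator_def mem_Times_iff)
  then have "set_lebesgue_integral lebesgue (?S \<times> {-\<epsilon>..0}) ?H \<le>
      integral\<^sup>L lebesgue (\<lambda>z. ?c0 * (?n + 1) * (indicator (?S \<times> {-(pi/2)..0}) z *\<^sub>R ?\<rho> z)
      - ?\<kappa> * (indicator (?S \<times> {-(pi/3)..-(pi/6)}) z *\<^sub>R (?\<beta> z * ?\<rho> z)))"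
    unfolding set_lebesgue_integral_def
    using iH i\<rho> i\<beta> unfolding set_integrable_def
    by (intro integral_mono Bochner_Integration.integrable_diff integrable_mult_right)
  also have "\<dots> = ?c0 * (?n + 1) * cell_volume (c, B) - ?\<kappa> * cell_energy (c, B)"
    using i\<rho> i\<beta> unfolding set_integrable_def cell_volume_def cell_energy_def set_lebesgue_integral_def prod.case
    by (subst Bochner_Integration.integral_diff) (simp_all add: integrable_mult_right)
  finally show ?thesis unfolding eq .
qed

lemma index_form_le:
  assumes cells: "cell_decomposition A (SOME cells. cell_decomposition A cells)" and dim: "2 \<le> DIM('e)"
    and \<epsilon>: "pi / 3 \<le> \<epsilon>" "\<epsilon> < pi / 2" "cos \<epsilon> \<le> 1/4"
  shows "index_form A \<phi> \<nu> \<epsilon> (test_function (cos \<epsilon>)) \<le>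
    cos \<epsilon> * (DIM('e) + 1) * sum cell_volume (SOME cells. cell_decomposition A cells)
    - (1/16) * (1/2) ^ DIM('e) * sum cell_energy (SOME cells. cell_decomposition A cells)"
proof -
  define C where "C = (SOME cells. cell_decomposition A cells)"
  have C: "cell_decomposition A C" using cells by (simp add: C_def)
  let ?f = "\<lambda>(c, B). (cone_chart c, B \<times> {-\<epsilon>..0})"
  let ?I = "\<lambda>(d, D). set_lebesgue_integral lebesgue (snd d ` D)
      (\<lambda>z. index_integrand (cos \<epsilon>) d z * vol_density (induced_metric (cone_map \<phi>) d) z)"
  have "inj_on ?f C"
  proof (rule inj_onI)
    fix x y assume eq: "?f x = ?f y"
    obtain c B d D where xy: "x = (c, B)" "y = (d, D)" by (cases x, cases y)
    have *: "cone_chart c = cone_chart d \<and> B \<times> {-\<epsilon>..0} = D \<times> {-\<epsilon>..0}"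
      using eq unfolding xy prod.case prod.inject .
    have "c = d" by (rule inj_cone_chart[OF conjunct1[OF *]])
    have "(0::real) \<in> {-\<epsilon>..0}" using \<epsilon> pi_gt_zero by simp
    then have "B = D" using conjunct2[OF *] by (rule Times_eq_cancel2[THEN iffD1])
    with \<open>c = d\<close> show "x = y" by (simp only: xy)
  qed
  then have "index_form A \<phi> \<nu> \<epsilon> (test_function (cos \<epsilon>)) = (\<Sum>cB\<in>C. ?I (?f cB))"
    unfolding index_form_def cell_integral_def truncated_cone_cells_def Let_def C_def[symmetric]
    by (subst sum.reindex) (auto simp: index_integrand_def Let_def o_def intro!: sum.cong)
  also have "\<dots> \<le> (\<Sum>cB\<in>C. cos \<epsilon> * (DIM('e) + 1) * cell_volume cB
      - (1/16) * (1/2) ^ DIM('e) * cell_energy cB)"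
  proof (rule sum_mono)
    fix cB assume "cB \<in> C"
    then show "?I (?f cB) \<le> cos \<epsilon> * (DIM('e) + 1) * cell_volume cB
      - (1/16) * (1/2) ^ DIM('e) * cell_energy cB"
      using cell_index_bound[OF C _ dim \<epsilon>] by (cases cB) simp
  qed
  also have "\<dots> = cos \<epsilon> * (DIM('e) + 1) * sum cell_volume C - (1/16) * (1/2) ^ DIM('e) * sum cell_energy C"
    by (simp only: sum_subtractf sum_distrib_left)
  finally show ?thesis by (simp only: C_def)
qed

lemma cone_unstable_if_not_totally_geodesic:
  assumes "closed_manifold A" "2 \<le> DIM('e)" "\<not> totally_geodesic A \<phi> \<nu>"
  shows "cone_unstable A \<phi> \<nu>"
proof -
  let ?C = "SOME cells. cell_decomposition A cells"
  define E where "E = (1/16) * (1/2) ^ DIM('e) * sum cell_energy ?C"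
  define V where "V = (DIM('e) + 1) * sum cell_volume ?C"
  have C: "cell_decomposition A ?C"
    using exists_cell_decomposition[OF assms(1)] by (rule someI_ex)
  then have fin: "finite ?C" unfolding cell_decomposition_def by blast
  obtain c B where "(c, B) \<in> ?C" "\<not> negligible {y \<in> snd c ` B. shape_norm2 \<phi> \<nu> c y \<noteq> 0}"
    using exists_cell_not_negligible[OF C assms(3)] .
  then have "0 < sum cell_energy ?C"
    using cell_energy_pos[OF C] cell_energy_nonneg[OF C] by (intro sum_pos2[OF fin, of "(c, B)"]) auto
  then have E: "0 < E" by (simp add: E_def)
  \<comment> \<open>\<open>1/4\<close> is what the lower bound on the test function tolerates; the
    other entry makes \<open>c0 * V\<close> at most \<open>E / 2\<close>. Using
    \<open>\<bar>V\<bar> + 1\<close> avoids both a zero denominator and the sign of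
    \<open>V\<close>.\<close>
  define c0 where "c0 = min (1/4) (E / (2 * (\<bar>V\<bar> + 1)))"
  have c0: "0 < c0" "c0 \<le> 1/4" using E by (simp_all only: c0_def min.cobounded1) simp
  have "c0 * V \<le> c0 * (\<bar>V\<bar> + 1)" using c0 by (intro mult_left_mono) auto
  also have "\<dots> \<le> E / (2 * (\<bar>V\<bar> + 1)) * (\<bar>V\<bar> + 1)"
    by (intro mult_right_mono) (auto simp: c0_def)
  also have "\<dots> = E / 2" by (simp add: divide_simps)
  finally have "c0 * V - E < 0" using E by linarith
  define \<epsilon> where "\<epsilon> = arccos c0"
  have cos: "cos \<epsilon> = c0" using c0 by (simp add: \<epsilon>_def)
  have range: "0 < \<epsilon>" "\<epsilon> < pi / 2"
    using arccos_lt_bounded[of c0] arccos_less_mono[of c0 0] c0 by (auto simp: \<epsilon>_def)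
  have "pi / 3 \<le> \<epsilon>"
  \<comment> \<open>\<open>cos \<epsilon> \<le> 1/4\<close> lies below
    \<open>cos (pi / 3) = 1/2\<close>, and cosine decreases.\<close>
  proof (rule ccontr)
    assume "\<not> pi / 3 \<le> \<epsilon>"
    then have "cos (pi / 3) < cos \<epsilon>" using range by (intro cos_monotone_0_pi) auto
    then show False using c0 cos by (simp add: cos_60)
  qed
  then have "index_form A \<phi> \<nu> \<epsilon> (test_function (cos \<epsilon>)) \<le> c0 * V - E"
    using index_form_le[OF C assms(2) _ range(2)] c0 by (simp add: cos V_def E_def mult.assoc)
  then have "index_form A \<phi> \<nu> \<epsilon> (test_function (cos \<epsilon>)) < 0"
    using \<open>c0 * V - E < 0\<close> by linarith
  moreover have "test_function (cos \<epsilon>) q = 0" if "q \<in> truncated_cone_boundary A \<epsilon>" for q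
    using that c0 cos by (auto simp: truncated_cone_boundary_def test_function_def tan_def)
  ultimately have "truncated_cone_unstable A \<phi> \<nu> \<epsilon>"
    unfolding truncated_cone_unstable_def using smooth_test_function by blast
  then show ?thesis unfolding cone_unstable_def using range by blast
qed

end

theorem theorem4p2:
  fixes A :: "('m::t2_space, 'e::euclidean_space) chart set"
    and \<phi> \<nu> :: "'m \<Rightarrow> 'v::euclidean_space"
  assumes "closed_manifold A"
    and "minimal_hypersurface A \<phi> \<nu>"
    and "2 \<le> DIM('e)" and "DIM('e) \<le> 14"
    and "\<not> totally_geodesic A \<phi> \<nu>"
  shows "cone_minimal_hypersurface A \<phi> \<nu> \<and> cone_unstable A \<phi> \<nu>"
proof -
  interpret oriented_immersion A \<phi> \<nu>
    using assms(2) by unfold_locales (simp add: minimal_hypersurface_def)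
  show ?thesis
    using assms cone_minimal cone_unstable_if_not_totally_geodesic
    by (auto simp: minimal_hypersurface_def)
qed

end
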